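(* Let $T\subseteq\omega^{<\omega}$ be a Laver tree, let $\mathcal{I}$ be an $F_\sigma$ $P$-ideal on $\omega$, and let $E\subseteq [T]\times[T]$ be a Borel equivalence relation on $[T]$ which is Borel reducible to $E_{\mathcal{I}}$. Then there is a Laver tree $S\subseteq T$ such that $E\cap([S]\times[S])$ is either the identity relation $\mathrm{id}([S])=\{(x,x):x\in[S]\}$ or the full relation $[S]\times[S]$.
   Context: A Laver tree is a tree $T\subseteq\omega^{<\omega}$ with a stem $s$ (the maximal node such that every other node of $T$ is compatible with it) such that every node of $T$ extending $s$ (including $s$ itself) has infinitely many immediate successors in $T$. The set of all infinite branches of $T$ is denoted $[T]\subseteq\omega^\omega$. An ideal $\mathcal{I}$ on $\omega$ is $F_\sigma$ if it is an $F_\sigma$ subset of $\mathcal{P}(\omega)$, identified with the Cantor space $2^\omega$. It is a $P$-ideal if for every sequence $(A_n)_{n\in\omega}$ of elements of $\mathcal{I}$ there is $A\in\mathcal{I}$ such that $A_n\setminus A$ is finite for every $n$. For a Borel ideal $\mathcal{I}$ on $\omega$, $E_{\mathcal{I}}$ is the equivalence relation on $2^\omega$ defined by $x\,E_{\mathcal{I}}\,y \iff \{n: x(n)\neq y(n)\}\in\mathcal{I}$. An equivalence relation on a standard Borel space $X$ is Borel if it is a Borel subset of $X\times X$. An equivalence relation $E$ on $X$ is Borel reducible to an equivalence relation $F$ on $Y$ if there is a Borel function $f:X\to Y$ such that for all $x,y\in X$: $x\,E\,y\iff f(x)\,F\,f(y)$. *)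

theory Defs
  imports "HOL-Analysis.Analysis" "HOL-Library.Sublist"
begin

definition is_tree :: "nat list set \<Rightarrow> bool" where
  "is_tree T \<longleftrightarrow> T \<noteq> {} \<and> (\<forall>t\<in>T. \<forall>u. prefix u t \<longrightarrow> u \<in> T)"

definition compatible_with_all :: "nat list set \<Rightarrow> nat list \<Rightarrow> bool" where
  "compatible_with_all T s \<longleftrightarrow> (\<forall>t\<in>T. prefix s t \<or> prefix t s)"

definition is_stem :: "nat list set \<Rightarrow> nat list \<Rightarrow> bool" where
  "is_stem T s \<longleftrightarrow> s \<in> T \<and> compatible_with_all T s \<and>
     \<not> (\<exists>t\<in>T. compatible_with_all T t \<and> strict_prefix s t)"

definition laver_tree :: "nat list set \<Rightarrow> bool" where
  "laver_tree T \<longleftrightarrow> is_tree T \<and>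
     (\<exists>s. is_stem T s \<and> (\<forall>t\<in>T. prefix s t \<longrightarrow> infinite {n. t @ [n] \<in> T}))"

definition branches :: "nat list set \<Rightarrow> (nat \<Rightarrow> nat) set" where
  "branches T = {x. \<forall>n. map x [0..<n] \<in> T}"

text \<open>Neither properness nor the inclusion of all finite sets is required of an ideal.\<close>

definition is_ideal :: "nat set set \<Rightarrow> bool" where
  "is_ideal I \<longleftrightarrow> {} \<in> I \<and> (\<forall>A\<in>I. \<forall>B. B \<subseteq> A \<longrightarrow> B \<in> I) \<and> (\<forall>A\<in>I. \<forall>B\<in>I. A \<union> B \<in> I)"

text \<open>The power set of \<open>nat\<close> is identified, via characteristic functions, with the Cantor space
  \<open>nat \<Rightarrow> bool\<close>, which carries the product of the discrete topologies on \<open>bool\<close>.\<close>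

definition fsigma_ideal :: "nat set set \<Rightarrow> bool" where
  "fsigma_ideal I \<longleftrightarrow> is_ideal I \<and> fsigma ((\<lambda>A n. n \<in> A) ` I)"

definition P_ideal :: "nat set set \<Rightarrow> bool" where
  "P_ideal I \<longleftrightarrow> is_ideal I \<and>
     (\<forall>A :: nat \<Rightarrow> nat set. (\<forall>n. A n \<in> I) \<longrightarrow> (\<exists>B\<in>I. \<forall>n. finite (A n - B)))"

definition E_ideal :: "nat set set \<Rightarrow> ((nat \<Rightarrow> bool) \<times> (nat \<Rightarrow> bool)) set" where
  "E_ideal I = {(x, y). {n. x n \<noteq> y n} \<in> I}"

text \<open>Borel spaces are represented by library measure spaces of which only the carrier and the
  \<open>\<sigma>\<close>-algebra are used.\<close>

definition borel_equivalence :: "'a measure \<Rightarrow> ('a \<times> 'a) set \<Rightarrow> bool" where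
  "borel_equivalence X E \<longleftrightarrow> equiv (space X) E \<and> E \<in> sets (X \<Otimes>\<^sub>M X)"

definition borel_reducible ::
  "'a measure \<Rightarrow> ('a \<times> 'a) set \<Rightarrow> 'b measure \<Rightarrow> ('b \<times> 'b) set \<Rightarrow> bool" where
  "borel_reducible X E Y F \<longleftrightarrow>
     (\<exists>f \<in> measurable X Y. \<forall>x\<in>space X. \<forall>y\<in>space X. (x, y) \<in> E \<longleftrightarrow> (f x, f y) \<in> F)"

definition branch_space :: "nat list set \<Rightarrow> (nat \<Rightarrow> nat) measure" where
  "branch_space T = restrict_space borel (branches T)"

end

theory Submission
  imports Defs
begin

text \<open>Let \<open>f\<close> reduce \<open>E\<close> to \<open>E\<^sub>I\<close>. A fusion argument shows that every Borel set contains or misses the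
  branches of a Laver subtree with the same stem. If on some Laver subtree all values of \<open>f\<close> agree
  modulo \<open>I\<close> and finite sets with a fixed \<open>z\<close>, then deciding finitely many coordinates of \<open>f\<close> makes
  all branches equivalent.

  Otherwise fusion gives a tree with limits \<open>g t\<close> at its nodes: on the branches through the \<open>n\<close>-th
  child of \<open>t\<close>, \<open>f\<close> agrees with \<open>g t\<close> up to a position tending to infinity with \<open>n\<close>, whereas no
  branch has a value equal to \<open>g t\<close> modulo \<open>I\<close> and finite sets. Choose nodes
  \<open>\<sigma> 0, \<sigma> 1, \<dots>\<close> of a subtree one at a time, each far enough out that \<open>f\<close> follows the limit at
  the parent up to \<open>N j\<close>. As \<open>I\<close> is a union of closed sets \<open>C k\<close>, \<open>N j\<close> can be taken so large that
  if \<open>g t\<close> and \<open>g u\<close> are inequivalent for two of the first nodes, then their difference below \<open>N j\<close>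
  excludes membership in \<open>C k\<close> for \<open>k \<le> j\<close>. As \<open>I\<close> is a P-ideal, there is one \<open>B \<in> I\<close> such that
  equivalent limits of the first nodes agree outside \<open>B\<close> from \<open>N j\<close> on.

  Let \<open>x \<noteq> y\<close> be branches whose values are equivalent, and let \<open>X j\<close>, \<open>Y j\<close> be their current nodes at
  stage \<open>j\<close>. By the choice for \<open>C k\<close>, \<open>g (X j)\<close> and \<open>g (Y j)\<close> are eventually equivalent, and since
  eventually only one of \<open>X\<close> and \<open>Y\<close> moves at a time, all these limits are equivalent. Where a move
  of \<open>X\<close> changes the limit outside \<open>B\<close>, \<open>Y\<close> rests, so \<open>f x\<close> and \<open>f y\<close> differ there. Hence \<open>f x\<close>
  agrees with a single limit modulo \<open>I\<close> and a finite set, a contradiction.\<close>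

section \<open>Laver trees with a given stem\<close>

abbreviation seg :: "(nat \<Rightarrow> nat) \<Rightarrow> nat \<Rightarrow> nat list" where
  "seg x n \<equiv> map x [0..<n]"

lemma take_seg: "take k (seg x n) = seg x (min k n)"
  by (simp add: take_map min_def)

lemma prefix_seg_seg: "k \<le> n \<Longrightarrow> prefix (seg x k) (seg x n)"
  using take_is_prefix[of k "seg x n"] by (simp add: take_seg min.absorb1)

lemma prefix_seg_iff: "prefix t (seg x n) \<longleftrightarrow> length t \<le> n \<and> seg x (length t) = t"
proof
  assume p: "prefix t (seg x n)"
  then have le: "length t \<le> n" using prefix_length_le by fastforce
  have "t = take (length t) (seg x n)" using p by (auto simp: prefix_def)
  also have "\<dots> = seg x (length t)" using le by (simp only: take_seg min.absorb1)
  finally show "length t \<le> n \<and> seg x (length t) = t" using le by simp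
next
  assume "length t \<le> n \<and> seg x (length t) = t"
  then show "prefix t (seg x n)" using prefix_seg_seg[of "length t" n x] by simp
qed

text \<open>The stem is a parameter because fusion and amalgamation have to shrink a tree without
  moving its stem.\<close>

definition laver_at :: "nat list \<Rightarrow> nat list set \<Rightarrow> bool" where
  "laver_at s T \<longleftrightarrow> is_tree T \<and> s \<in> T \<and> compatible_with_all T s \<and>
     (\<forall>t\<in>T. prefix s t \<longrightarrow> infinite {n. t @ [n] \<in> T})"

lemma laver_atI:
  assumes "\<And>t u. t \<in> T \<Longrightarrow> prefix u t \<Longrightarrow> u \<in> T" "s \<in> T" "\<And>t. t \<in> T \<Longrightarrow> prefix s t \<or> prefix t s"
    "\<And>t. t \<in> T \<Longrightarrow> prefix s t \<Longrightarrow> infinite {n. t @ [n] \<in> T}"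
  shows "laver_at s T"
  using assms unfolding laver_at_def is_tree_def compatible_with_all_def by blast

lemma laver_atD:
  assumes "laver_at s T"
  shows "t \<in> T \<Longrightarrow> prefix u t \<Longrightarrow> u \<in> T" "s \<in> T" "t \<in> T \<Longrightarrow> prefix s t \<or> prefix t s"
    "t \<in> T \<Longrightarrow> prefix s t \<Longrightarrow> infinite {n. t @ [n] \<in> T}"
  using assms unfolding laver_at_def is_tree_def compatible_with_all_def by blast+

text \<open>Maximality of the stem comes from splitting: a longer node passes through one child of
  \<open>s\<close> and is incompatible with every other child.\<close>

lemma laver_tree_iff: "laver_tree T \<longleftrightarrow> (\<exists>s. laver_at s T)"
proof
  assume "laver_tree T"
  then show "\<exists>s. laver_at s T"
    unfolding laver_tree_def is_stem_def laver_at_def by blast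
next
  assume "\<exists>s. laver_at s T"
  then obtain s where s: "laver_at s T" ..
  have "\<not> (\<exists>t\<in>T. compatible_with_all T t \<and> strict_prefix s t)"
  proof
    assume "\<exists>t\<in>T. compatible_with_all T t \<and> strict_prefix s t"
    then obtain t where t: "t \<in> T" "compatible_with_all T t" "strict_prefix s t" by blast
    from t(3) obtain a v where tv: "t = s @ a # v" by (rule strict_prefixE')
    have "infinite ({n. s @ [n] \<in> T} - {a})"
      using laver_atD(2,4)[OF s] by (simp add: Diff_infinite_finite)
    then have "{n. s @ [n] \<in> T} - {a} \<noteq> {}" by (rule infinite_imp_nonempty)
    then obtain n where n: "s @ [n] \<in> T" "n \<noteq> a" by blast
    then have "prefix t (s @ [n]) \<or> prefix (s @ [n]) t"
      using t(2) unfolding compatible_with_all_def by blast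
    with n(2) show False unfolding tv by auto
  qed
  with s show "laver_tree T"
    unfolding laver_tree_def is_stem_def laver_at_def by blast
qed

section \<open>Cones of a tree, its branches, and amalgamation\<close>

definition restr :: "nat list set \<Rightarrow> nat list \<Rightarrow> nat list set" where
  "restr T t = {u \<in> T. prefix u t \<or> prefix t u}"

lemma restr_subset: "restr T t \<subseteq> T"
  by (auto simp: restr_def)

lemma laver_at_restr:
  assumes "laver_at s T" "t \<in> T" "prefix s t"
  shows "laver_at t (restr T t)"
proof (rule laver_atI)
  fix u v assume "u \<in> restr T t" "prefix v u"
  then show "v \<in> restr T t"
    using laver_atD(1)[OF assms(1)] prefix_order.trans prefix_same_cases
    unfolding restr_def by blast
next
  show "t \<in> restr T t" using assms by (simp add: restr_def)
next
  fix u assume "u \<in> restr T t" then show "prefix t u \<or> prefix u t" by (auto simp: restr_def)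
next
  fix u assume u: "u \<in> restr T t" "prefix t u"
  then have "{n. u @ [n] \<in> restr T t} = {n. u @ [n] \<in> T}"
    by (auto simp: restr_def)
  with u assms show "infinite {n. u @ [n] \<in> restr T t}"
    using laver_atD(4)[OF assms(1), of u] prefix_order.trans[of s t u] by (simp add: restr_def)
qed

lemma branches_mono: "S \<subseteq> T \<Longrightarrow> branches S \<subseteq> branches T"
  by (auto simp: branches_def)

lemma branchesD: "x \<in> branches T \<Longrightarrow> seg x n \<in> T"
  by (simp add: branches_def)

lemma branch_extends_stem:
  assumes "laver_at s T" "x \<in> branches T"
  shows "seg x (length s) = s"
  using laver_atD(3)[OF assms(1) branchesD[OF assms(2), of "length s"]]
proof
  assume "prefix s (seg x (length s))"
  then show ?thesis by (simp add: prefix_seg_iff)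
next
  assume "prefix (seg x (length s)) s"
  then obtain z where z: "s = seg x (length s) @ z" by (auto simp: prefix_def)
  then have "length s = length (seg x (length s) @ z)" by simp
  then have "z = []" by simp
  with z show ?thesis by simp
qed

lemma branch_restr:
  assumes "x \<in> branches T" "seg x (length t) = t"
  shows "x \<in> branches (restr T t)"
proof -
  have "prefix (seg x n) t \<or> prefix t (seg x n)" for n
    using prefix_seg_seg[of n "length t" x] prefix_seg_seg[of "length t" n x] assms(2) by force
  with assms(1) show ?thesis by (simp add: branches_def restr_def)
qed

text \<open>Splitting at \<open>s\<close> comes from the infinite index set \<open>A\<close>. A node
  of \<open>W n\<close> properly above \<open>s\<close> extends \<open>s @ [n]\<close> and keeps its
  successors in \<open>W n\<close>.\<close>

lemma laver_at_amalgamate: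
  assumes inf: "infinite A" and W: "\<And>n. n \<in> A \<Longrightarrow> laver_at (s @ [n]) (W n)"
  shows "laver_at s (\<Union>n\<in>A. W n)"
proof (rule laver_atI)
  fix t u assume "t \<in> (\<Union>n\<in>A. W n)" "prefix u t"
  then obtain n where n: "n \<in> A" "t \<in> W n" "prefix u t" by blast
  from n laver_atD(1)[OF W[OF n(1)] n(2,3)] show "u \<in> (\<Union>n\<in>A. W n)" by blast
next
  obtain n where n: "n \<in> A" using inf by fastforce
  have "s \<in> W n" by (rule laver_atD(1)[OF W[OF n] laver_atD(2)[OF W[OF n]]]) simp
  with n show "s \<in> (\<Union>n\<in>A. W n)" by blast
next
  fix t assume "t \<in> (\<Union>n\<in>A. W n)"
  then obtain n where n: "n \<in> A" "t \<in> W n" by blast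
  with laver_atD(3)[OF W] have "prefix (s @ [n]) t \<or> prefix t (s @ [n])" by blast
  then show "prefix s t \<or> prefix t s"
    by (auto simp: prefix_snoc dest: append_prefixD)
next
  fix t assume t: "t \<in> (\<Union>n\<in>A. W n)" "prefix s t"
  then obtain n where n: "n \<in> A" "t \<in> W n" by blast
  show "infinite {n. t @ [n] \<in> (\<Union>n\<in>A. W n)}"
  proof (cases "t = s")
    case True
    have "A \<subseteq> {n. t @ [n] \<in> (\<Union>n\<in>A. W n)}"
      using laver_atD(2)[OF W] True by auto
    with inf show ?thesis using finite_subset by blast
  next
    case False
    then have "prefix (s @ [n]) t"
      using laver_atD(3)[OF W[OF n(1)] n(2)] t(2) prefix_order.antisym[of s t]
      by (auto simp: prefix_snoc)
    then have "infinite {m. t @ [m] \<in> W n}" using laver_atD(4)[OF W[OF n(1)] n(2)] by blast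
    moreover have "{m. t @ [m] \<in> W n} \<subseteq> {n. t @ [n] \<in> (\<Union>n\<in>A. W n)}" using n by blast
    ultimately show ?thesis using finite_subset by blast
  qed
qed

text \<open>The first entry of \<open>x\<close> past \<open>s\<close> determines the piece
  \<open>W n\<close> that contains the long initial segments of \<open>x\<close>; the short ones
  follow by closure under prefixes.\<close>

lemma branches_amalgamate:
  assumes W: "\<And>n. n \<in> A \<Longrightarrow> laver_at (s @ [n]) (W n)"
    and x: "x \<in> branches (\<Union>n\<in>A. W n)"
  obtains n where "n \<in> A" "seg x (Suc (length s)) = s @ [n]" "x \<in> branches (W n)"
proof -
  have *: "\<exists>n\<in>A. seg x k \<in> W n \<and> seg x (Suc (length s)) = s @ [n]" if k: "k > length s" for k
  proof -
    obtain n where n: "n \<in> A" "seg x k \<in> W n" using branchesD[OF x, of k] by blast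
    then have "prefix (s @ [n]) (seg x k) \<or> prefix (seg x k) (s @ [n])"
      using laver_atD(3)[OF W] by blast
    then have "prefix (s @ [n]) (seg x k)"
      using k by (auto simp: prefix_snoc dest: prefix_length_le)
    with n show ?thesis unfolding prefix_seg_iff by auto
  qed
  from *[of "Suc (length s)"] obtain n where n: "n \<in> A" "seg x (Suc (length s)) = s @ [n]" by auto
  have "seg x k \<in> W n" for k
  proof -
    from *[of "max k (Suc (length s))"] n(2) have "seg x (max k (Suc (length s))) \<in> W n"
      by auto
    then show ?thesis by (rule laver_atD(1)[OF W[OF n(1)]]) (simp add: prefix_seg_seg)
  qed
  then show thesis using that n by (auto simp: branches_def)
qed

section \<open>Fusion\<close>

text \<open>The list \<open>w\<close> stands for the node \<open>s @ rev w\<close>, so that consing to \<open>w\<close> appends to the node.\<close>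

primrec fusion_step :: "(nat list \<Rightarrow> nat list set \<Rightarrow> nat list set) \<Rightarrow> nat list \<Rightarrow> nat list set \<Rightarrow>
    nat list \<Rightarrow> nat list set" where
  "fusion_step v s T [] = v s T"
| "fusion_step v s T (n # w) = v (s @ rev (n # w)) (restr (fusion_step v s T w) (s @ rev (n # w)))"

text \<open>\<open>fusion_step\<close> has a value at every list, but the value is known to be a
  Laver tree only along paths all of whose nodes survive; this predicate singles them out.\<close>

primrec fusion_ok :: "(nat list \<Rightarrow> nat list set \<Rightarrow> nat list set) \<Rightarrow> nat list \<Rightarrow> nat list set \<Rightarrow>
    nat list \<Rightarrow> bool" where
  "fusion_ok v s T [] = True"
| "fusion_ok v s T (n # w) = (fusion_ok v s T w \<and> s @ rev (n # w) \<in> fusion_step v s T w)"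

text \<open>\<open>v\<close> is applied once at each surviving node and keeps that node as the stem.
  Later applications act above single children, so none of the infinitely many children left at a
  node is lost afterwards.\<close>

lemma laver_fusion:
  assumes T: "laver_at s T"
    and dense: "\<And>t U. laver_at t U \<Longrightarrow> U \<subseteq> T \<Longrightarrow> prefix s t \<Longrightarrow> \<exists>V\<subseteq>U. laver_at t V \<and> Q t V"
    and hered: "\<And>t V W. Q t V \<Longrightarrow> W \<subseteq> V \<Longrightarrow> Q t W"
  obtains S where "S \<subseteq> T" "laver_at s S" "\<And>t. t \<in> S \<Longrightarrow> prefix s t \<Longrightarrow> Q t (restr S t)"
proof -
  have "\<forall>t U. \<exists>V. laver_at t U \<longrightarrow> U \<subseteq> T \<longrightarrow> prefix s t \<longrightarrow> V \<subseteq> U \<and> laver_at t V \<and> Q t V"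
    using dense by blast
  then obtain v where v: "\<And>t U. laver_at t U \<Longrightarrow> U \<subseteq> T \<Longrightarrow> prefix s t \<Longrightarrow>
      v t U \<subseteq> U \<and> laver_at t (v t U) \<and> Q t (v t U)"
    by metis
  let ?F = "fusion_step v s T" and ?ok = "fusion_ok v s T"
  have F: "?F w \<subseteq> T \<and> laver_at (s @ rev w) (?F w) \<and> Q (s @ rev w) (?F w)" if "?ok w" for w
    using that
  proof (induction w)
    case Nil
    then show ?case using v[OF T] by simp
  next
    case (Cons n w)
    then have IH: "?F w \<subseteq> T" "laver_at (s @ rev w) (?F w)" "s @ rev (n # w) \<in> ?F w" by auto
    from laver_at_restr[OF IH(2,3)] have "laver_at (s @ rev (n # w)) (restr (?F w) (s @ rev (n # w)))"
      by simp
    from v[OF this] IH(1) restr_subset show ?case by fastforce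
  qed
  have sub: "?F (n # w) \<subseteq> ?F w" if "?ok (n # w)" for n w
  proof -
    have IH: "?F w \<subseteq> T" "laver_at (s @ rev w) (?F w)" "s @ rev (n # w) \<in> ?F w" using that F by auto
    from laver_at_restr[OF IH(2,3)] have "laver_at (s @ rev (n # w)) (restr (?F w) (s @ rev (n # w)))"
      by simp
    from v[OF this] IH(1) restr_subset show ?thesis by fastforce
  qed
  have sub': "?ok (w' @ w) \<Longrightarrow> ?ok w \<and> ?F (w' @ w) \<subseteq> ?F w" for w' w
  proof (induction w')
    case (Cons n w')
    then show ?case using sub[of n "w' @ w"] by auto
  qed simp
  define S where "S = {u. prefix u s} \<union> {s @ rev w |w. ?ok w}"
  have S_iff: "s @ u \<in> S \<longleftrightarrow> ?ok (rev u)" for u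
  proof -
    have "?ok (rev u)" if "prefix (s @ u) s" using that by (cases u) (auto dest: prefix_length_le)
    moreover have "(\<exists>w. s @ u = s @ rev w \<and> ?ok w) \<longleftrightarrow> ?ok (rev u)"
      by (metis rev_rev_ident same_append_eq)
    ultimately show ?thesis unfolding S_def by blast
  qed
  \<comment> \<open>The whole part of \<open>S\<close> comparable with \<open>s @ w\<close> lies in
    the tree chosen at \<open>s @ w\<close>. For \<open>w = []\<close> this gives
    \<open>S \<subseteq> T\<close>; in general it gives \<open>Q\<close> on the cone of
    \<open>S\<close> by heredity.\<close>
  have mem: "u \<in> ?F (rev w)" if "s @ w \<in> S" "u \<in> S" "prefix u (s @ w) \<or> prefix (s @ w) u" for u w
    using that(3)
  proof
    assume "prefix u (s @ w)"
    moreover have "laver_at (s @ w) (?F (rev w))" using F[of "rev w"] that(1) S_iff by simp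
    ultimately show ?thesis using laver_atD(1,2) by blast
  next
    assume "prefix (s @ w) u"
    then obtain w' where u: "u = s @ w @ w'" by (auto simp: prefix_def)
    with that(2) S_iff have ok: "?ok (rev w' @ rev w)" by simp
    then have "u \<in> ?F (rev w' @ rev w)" using F[OF ok] laver_atD(2) u by fastforce
    with sub'[OF ok] show ?thesis by blast
  qed
  have S_T: "S \<subseteq> T"
  proof
    fix u assume u: "u \<in> S"
    have "s \<in> S" by (simp add: S_def)
    with mem[of "[]" u] u have "u \<in> ?F []" unfolding S_def by auto
    with F[of "[]"] show "u \<in> T" by auto
  qed
  have ext: "\<exists>w. t = s @ w" if "prefix s t" for t using that by (auto simp: prefix_def)
  have down: "s @ w' \<in> S" if "s @ w' @ w'' \<in> S" for w' w''
    using that sub'[of "rev w''" "rev w'"] by (simp add: S_iff)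
  have "laver_at s S"
  proof (rule laver_atI)
    fix t u assume t: "t \<in> S" "prefix u t"
    show "u \<in> S"
    proof (cases "prefix u s")
      case False
      have "prefix s t" using t False prefix_order.trans unfolding S_def by fastforce
      with False t(2) have "prefix s u" using prefix_same_cases by blast
      then obtain w' where "u = s @ w'" using ext by blast
      with t down show ?thesis by (auto simp: prefix_def)
    qed (simp add: S_def)
  next
    show "s \<in> S" by (simp add: S_def)
  next
    fix t assume "t \<in> S" then show "prefix s t \<or> prefix t s" by (auto simp: S_def)
  next
    fix t assume t: "t \<in> S" "prefix s t"
    then obtain w where w: "t = s @ w" using ext by blast
    with t have ok: "?ok (rev w)" by (simp add: S_iff)
    have "t @ [n] \<in> S \<longleftrightarrow> t @ [n] \<in> ?F (rev w)" for n
      using S_iff[of "w @ [n]"] ok by (simp add: w)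
    moreover have "infinite {n. t @ [n] \<in> ?F (rev w)}"
      using F[OF ok] laver_atD(2,4) w by fastforce
    ultimately show "infinite {n. t @ [n] \<in> S}" by simp
  qed
  moreover have "Q t (restr S t)" if t: "t \<in> S" "prefix s t" for t
  proof -
    obtain w where w: "t = s @ w" using ext t by blast
    with t have "?ok (rev w)" by (simp add: S_iff)
    with F have "Q t (?F (rev w))" by (metis rev_rev_ident w)
    moreover have "restr S t \<subseteq> ?F (rev w)" using mem t w by (auto simp: restr_def)
    ultimately show ?thesis using hered by blast
  qed
  ultimately show thesis using that S_T by blast
qed

text \<open>\<open>B n\<close> is dealt with at the nodes \<open>n\<close> levels above the stem,
  and every branch passes through one of them.\<close>

lemma laver_avoid_countable:
  fixes B :: "nat \<Rightarrow> (nat \<Rightarrow> nat) set"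
  assumes T: "laver_at s T"
    and avoid: "\<And>n t U. laver_at t U \<Longrightarrow> U \<subseteq> T \<Longrightarrow> prefix s t \<Longrightarrow>
      \<exists>V\<subseteq>U. laver_at t V \<and> branches V \<inter> B n = {}"
  shows "\<exists>S\<subseteq>T. laver_at s S \<and> (\<forall>n. branches S \<inter> B n = {})"
proof -
  obtain S where S: "S \<subseteq> T" "laver_at s S"
    "\<And>t. t \<in> S \<Longrightarrow> prefix s t \<Longrightarrow> branches (restr S t) \<inter> B (length t - length s) = {}"
  proof (rule laver_fusion[OF T, where Q = "\<lambda>t V. branches V \<inter> B (length t - length s) = {}"])
    show "\<exists>V\<subseteq>U. laver_at t V \<and> branches V \<inter> B (length t - length s) = {}"
      if "laver_at t U" "U \<subseteq> T" "prefix s t" for t U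
      using avoid that by blast
  next
    show "branches W \<inter> B (length t - length s) = {}"
      if "branches V \<inter> B (length t - length s) = {}" "W \<subseteq> V" for t V W
      using that branches_mono by blast
  qed blast
  have "x \<notin> B n" if x: "x \<in> branches S" for x n
  proof -
    let ?t = "seg x (length s + n)"
    have "prefix s ?t" unfolding prefix_seg_iff using branch_extends_stem[OF S(2) x] by simp
    moreover have "x \<in> branches (restr S ?t)" by (rule branch_restr[OF x]) simp
    ultimately show ?thesis using S(3)[OF branchesD[OF x], of "length s + n"] by auto
  qed
  with S show ?thesis by blast
qed

section \<open>Borel sets are decided by trees with the same stem\<close>

text \<open>The deciding subtree keeps the stem \<open>s\<close>, so that deciding subtrees at
  different nodes can be amalgamated or fused.\<close>

definition decided :: "(nat \<Rightarrow> nat) set \<Rightarrow> bool" where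
  "decided B \<longleftrightarrow> (\<forall>s T. laver_at s T \<longrightarrow>
     (\<exists>S\<subseteq>T. laver_at s S \<and> (branches S \<subseteq> B \<or> branches S \<inter> B = {})))"

text \<open>If \<open>t\<close> is an initial segment of the stem, all branches are inside; if the
  two are incompatible, none is. If \<open>t\<close> properly extends the stem, the child of the
  stem leading to \<open>t\<close> is dropped.\<close>

lemma decided_cylinder: "decided {x. seg x (length t) = t}"
  unfolding decided_def
proof (intro allI impI)
  fix s T assume T: "laver_at s T"
  consider "prefix t s" | "parallel s t" | "strict_prefix s t"
    unfolding strict_prefix_def parallel_def by blast
  then show "\<exists>S\<subseteq>T. laver_at s S \<and>
      (branches S \<subseteq> {x. seg x (length t) = t} \<or> branches S \<inter> {x. seg x (length t) = t} = {})"
  proof cases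
    case 1
    have "seg x (length t) = t" if "x \<in> branches T" for x
    proof -
      have "prefix t (seg x (length s))" using branch_extends_stem[OF T that] 1 by simp
      then show ?thesis unfolding prefix_seg_iff ..
    qed
    with T show ?thesis by (intro exI[of _ T]) auto
  next
    case 2
    have "seg x (length t) \<noteq> t" if "x \<in> branches T" for x
    proof
      assume "seg x (length t) = t"
      moreover have "seg x (length s) = s" by (rule branch_extends_stem[OF T that])
      ultimately have "length s \<le> length t \<Longrightarrow> prefix s t" "length t \<le> length s \<Longrightarrow> prefix t s"
        using prefix_seg_seg[of "length s" "length t" x] prefix_seg_seg[of "length t" "length s" x]
        by simp_all
      with 2 show False by (meson linear parallelE)
    qed
    with T show ?thesis by (intro exI[of _ T]) auto
  next
    case 3
    then obtain a v where tv: "t = s @ a # v" by (rule strict_prefixE')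
    \<comment> \<open>Removing this cone costs a node outside it at most the child with entry
      \<open>a\<close>, so infinite splitting survives.\<close>
    let ?S = "{u \<in> T. \<not> prefix (s @ [a]) u}"
    have "laver_at s ?S"
    proof (rule laver_atI)
      fix u assume u: "u \<in> ?S" "prefix s u"
      have "{n. u @ [n] \<in> T} - {a} \<subseteq> {n. u @ [n] \<in> ?S}"
      proof
        fix n assume "n \<in> {n. u @ [n] \<in> T} - {a}"
        moreover have "s @ [a] \<noteq> u @ [n]" if "n \<noteq> a" using that by simp
        ultimately show "n \<in> {n. u @ [n] \<in> ?S}" using u(1) unfolding mem_Collect_eq prefix_snoc by blast
      qed
      moreover have "infinite ({n. u @ [n] \<in> T} - {a})"
        using u laver_atD(4)[OF T] by (simp add: Diff_infinite_finite)
      ultimately show "infinite {n. u @ [n] \<in> ?S}" using finite_subset by blast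
    next
      fix u v assume "u \<in> ?S" "prefix v u"
      then show "v \<in> ?S" using laver_atD(1)[OF T] prefix_order.trans by blast
    next
      show "s \<in> ?S" using laver_atD(2)[OF T] by (auto dest: prefix_length_le)
    next
      fix u assume "u \<in> ?S" then show "prefix s u \<or> prefix u s" using laver_atD(3)[OF T] by blast
    qed
    moreover have "seg x (length t) \<noteq> t" if "x \<in> branches ?S" for x
    proof
      assume "seg x (length t) = t"
      then have "t \<in> ?S" using branchesD[OF that, of "length t"] by (simp only:)
      then show False by (simp add: tv)
    qed
    ultimately show ?thesis by (intro exI[of _ ?S]) auto
  qed
qed

lemma decided_Compl: "decided B \<Longrightarrow> decided (- B)"
proof -
  have "branches S \<subseteq> B \<or> branches S \<inter> B = {} \<longleftrightarrow> branches S \<subseteq> - B \<or> branches S \<inter> - B = {}" for S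
    by blast
  then show "decided B \<Longrightarrow> decided (- B)" by (simp add: decided_def)
qed

text \<open>A node with infinitely many good children is good, by amalgamation. Hence if the stem is
  not good, the nodes reached without meeting a good node form a Laver tree. No subtree at such a
  node has all its branches in one \<open>B n\<close>, so each \<open>B n\<close> is decided
  negatively, and a fusion avoids all of them at once.\<close>

lemma decided_UN:
  fixes B :: "nat \<Rightarrow> (nat \<Rightarrow> nat) set"
  assumes B: "\<And>n. decided (B n)"
  shows "decided (\<Union>n. B n)"
  unfolding decided_def
proof (intro allI impI)
  fix s T assume T: "laver_at s T"
  let ?B = "\<Union>n. B n"
  define good where "good t \<longleftrightarrow> (\<exists>S\<subseteq>T. laver_at t S \<and> branches S \<subseteq> ?B)" for t
  show "\<exists>S\<subseteq>T. laver_at s S \<and> (branches S \<subseteq> ?B \<or> branches S \<inter> ?B = {})"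
  proof (cases "good s")
    case True
    then obtain S where "S \<subseteq> T" "laver_at s S" "branches S \<subseteq> ?B" unfolding good_def by blast
    then show ?thesis by (intro exI[of _ S]) auto
  next
    case False
    let ?S = "{u \<in> T. \<forall>v. prefix s v \<longrightarrow> prefix v u \<longrightarrow> \<not> good v}"
    have "laver_at s ?S"
    proof (rule laver_atI)
      fix u assume u: "u \<in> ?S" "prefix s u"
      have "finite {n. u @ [n] \<in> T \<and> good (u @ [n])}"
      proof (rule ccontr)
        let ?A = "{n. u @ [n] \<in> T \<and> good (u @ [n])}"
        assume inf: "infinite ?A"
        have "\<forall>n\<in>?A. \<exists>V. V \<subseteq> T \<and> laver_at (u @ [n]) V \<and> branches V \<subseteq> ?B"
          unfolding good_def by simp
        from bchoice[OF this] obtain W where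
          W: "\<And>n. n \<in> ?A \<Longrightarrow> W n \<subseteq> T \<and> laver_at (u @ [n]) (W n) \<and> branches (W n) \<subseteq> ?B"
          by blast
        have "laver_at u (\<Union>n\<in>?A. W n)"
          by (rule laver_at_amalgamate[OF inf]) (use W in simp)
        moreover have "x \<in> ?B" if x: "x \<in> branches (\<Union>n\<in>?A. W n)" for x
        proof -
          have "laver_at (u @ [n]) (W n)" if "n \<in> ?A" for n using W[OF that] by simp
          from branches_amalgamate[OF this x] obtain n where "n \<in> ?A" "x \<in> branches (W n)" by blast
          with W show ?thesis by blast
        qed
        moreover have "(\<Union>n\<in>?A. W n) \<subseteq> T" using W by blast
        ultimately have "(\<Union>n\<in>?A. W n) \<subseteq> T \<and> laver_at u (\<Union>n\<in>?A. W n) \<and> branches (\<Union>n\<in>?A. W n) \<subseteq> ?B"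
          by (intro conjI) (assumption | rule subsetI)+
        then have "good u" unfolding good_def by (rule exI)
        with u show False by simp
      qed
      moreover have "{n. u @ [n] \<in> T} - {n. u @ [n] \<in> T \<and> good (u @ [n])} \<subseteq> {n. u @ [n] \<in> ?S}"
        using u(1) by (auto simp: prefix_snoc)
      moreover have "infinite {n. u @ [n] \<in> T}" using u laver_atD(4)[OF T] by simp
      ultimately show "infinite {n. u @ [n] \<in> ?S}" by (meson Diff_infinite_finite finite_subset)
    next
      fix u v assume "u \<in> ?S" "prefix v u"
      then show "v \<in> ?S" using laver_atD(1)[OF T] prefix_order.trans by blast
    next
      show "s \<in> ?S" using laver_atD(2)[OF T] False prefix_order.antisym by blast
    next
      fix u assume "u \<in> ?S" then show "prefix s u \<or> prefix u s" using laver_atD(3)[OF T] by blast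
    qed
    moreover have "\<exists>V\<subseteq>U. laver_at t V \<and> branches V \<inter> B n = {}"
      if U: "laver_at t U" "U \<subseteq> ?S" "prefix s t" for n t U
    proof -
      obtain V where V: "V \<subseteq> U" "laver_at t V" "branches V \<subseteq> B n \<or> branches V \<inter> B n = {}"
        using B U(1) unfolding decided_def by blast
      have "t \<in> ?S" using laver_atD(2)[OF U(1)] U(2) by blast
      then have "\<not> good t" using U(3) by simp
      moreover have "V \<subseteq> T" using U(2) V(1) by blast
      ultimately have "\<not> branches V \<subseteq> B n" using V(2) unfolding good_def by blast
      with V show ?thesis by (intro exI[of _ V]) simp
    qed
    ultimately have "\<exists>S\<subseteq>?S. laver_at s S \<and> (\<forall>n. branches S \<inter> B n = {})"
      by (rule laver_avoid_countable)
    then obtain S where "S \<subseteq> ?S" "laver_at s S" "\<forall>n. branches S \<inter> B n = {}" by blast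
    then show ?thesis by (intro exI[of _ S]) blast
  qed
qed

lemma decided_Union_countable:
  assumes "countable F" "\<And>A. A \<in> F \<Longrightarrow> decided A"
  shows "decided (\<Union>F)"
proof (cases "F = {}")
  case True
  then show ?thesis unfolding decided_def by auto
next
  case False
  with assms(1) have "\<Union>F = (\<Union>n. from_nat_into F n)" by (simp add: range_from_nat_into)
  also have "decided \<dots>" by (rule decided_UN) (simp add: assms(2) False from_nat_into)
  finally show ?thesis .
qed

text \<open>The Borel sets are generated by conditions on one coordinate, and a condition on
  coordinate \<open>i\<close> is a countable union of cylinders given by lists of length
  \<open>Suc i\<close>.\<close>

lemma decided_borel:
  fixes B :: "(nat \<Rightarrow> nat) set"
  assumes "B \<in> sets borel"
  shows "decided B"
proof -
  have "B \<in> sigma_sets UNIV {{x::nat \<Rightarrow> nat. x i \<in> A} |i A. A \<in> sets borel}"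
    using assms unfolding sets_PiM_equal_borel[symmetric] sets_PiM_single
    by (simp add: PiE_UNIV_domain)
  then show ?thesis
  proof (induction rule: sigma_sets.induct)
    case (Basic a)
    then obtain i A where a: "a = {x. x i \<in> A}" by blast
    let ?F = "(\<lambda>t. {x::nat \<Rightarrow> nat. seg x (length t) = t}) ` {t. length t = Suc i \<and> t ! i \<in> A}"
    have "a = \<Union>?F"
    proof (intro equalityI subsetI)
      fix x assume "x \<in> a"
      then show "x \<in> \<Union>?F" unfolding a by (auto intro!: exI[of _ "seg x (Suc i)"] simp del: upt_Suc)
    next
      fix x assume "x \<in> \<Union>?F"
      then obtain t where t: "length t = Suc i" "t ! i \<in> A" "seg x (length t) = t" by blast
      then have "t ! i = x i" by (metis diff_zero lessI nth_map_upt add_0)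
      with t show "x \<in> a" unfolding a by simp
    qed
    also have "decided \<dots>"
      by (rule decided_Union_countable) (simp, elim imageE, simp only: decided_cylinder)
    finally show ?case .
  next
    case Empty
    then show ?case unfolding decided_def by auto
  next
    case (Compl a)
    then show ?case using decided_Compl by (simp add: Compl_eq_Diff_UNIV)
  next
    case (Union a)
    then show ?case using decided_UN by blast
  qed
qed

text \<open>Measurability on the branch space only yields the trace of a Borel set on
  \<open>branches T\<close>; deciding that Borel set on a subtree of \<open>T\<close> decides its
  trace.\<close>

lemma borel_function_decided:
  assumes f: "f \<in> measurable (restrict_space borel (branches T)) M"
    and A: "A \<in> sets M" and U: "laver_at t U" "U \<subseteq> T"
  obtains V where "V \<subseteq> U" "laver_at t V" "(\<forall>x\<in>branches V. f x \<in> A) \<or> (\<forall>x\<in>branches V. f x \<notin> A)"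
proof -
  have "f -` A \<inter> branches T \<in> sets (restrict_space borel (branches T))"
    using measurable_sets[OF f A] by (simp add: space_restrict_space)
  then obtain B where B: "B \<in> sets borel" "f -` A \<inter> branches T = branches T \<inter> B"
    by (auto simp: sets_restrict_space)
  obtain V where V: "V \<subseteq> U" "laver_at t V" "branches V \<subseteq> B \<or> branches V \<inter> B = {}"
    using decided_borel[OF B(1)] U(1) unfolding decided_def by blast
  have "branches V \<subseteq> branches T" using V(1) U(2) branches_mono by blast
  with V B(2) show thesis by (intro that[OF V(1,2)]) blast
qed

section \<open>Fusion for a function into the Cantor space\<close>

abbreviation differ :: "(nat \<Rightarrow> bool) \<Rightarrow> (nat \<Rightarrow> bool) \<Rightarrow> nat set" where
  "differ w z \<equiv> {n. w n \<noteq> z n}"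

lemma ideal_subset: "is_ideal I \<Longrightarrow> A \<in> I \<Longrightarrow> B \<subseteq> A \<Longrightarrow> B \<in> I"
  unfolding is_ideal_def by blast

lemma ideal_Un: "is_ideal I \<Longrightarrow> A \<in> I \<Longrightarrow> B \<in> I \<Longrightarrow> A \<union> B \<in> I"
  unfolding is_ideal_def by blast

lemma differ_trans:
  assumes "is_ideal I" "differ a b \<in> I" "differ b c \<in> I"
  shows "differ a c \<in> I"
  by (rule ideal_subset[OF assms(1) ideal_Un[OF assms]]) auto

lemma char_fun_image_iff: "(\<lambda>n. P n) \<in> (\<lambda>A n. n \<in> A) ` I \<longleftrightarrow> {n. P n} \<in> I"
proof
  assume "(\<lambda>n. P n) \<in> (\<lambda>A n. n \<in> A) ` I"
  then obtain A where "A \<in> I" "P = (\<lambda>n. n \<in> A)" by blast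
  then show "{n. P n} \<in> I" by simp
next
  assume "{n. P n} \<in> I"
  then show "(\<lambda>n. P n) \<in> (\<lambda>A n. n \<in> A) ` I" by (rule rev_image_eqI) simp
qed

lemma coordinate_borel: "{w :: nat \<Rightarrow> bool. w k} \<in> sets borel"
proof -
  have "open ((\<lambda>w :: nat \<Rightarrow> bool. w k) -` {True})"
    by (rule open_vimage) (simp_all add: open_discrete)
  then show ?thesis by (simp add: vimage_def)
qed

lemma fsigma_idealE:
  assumes "fsigma ((\<lambda>A n. n \<in> A) ` I)"
  obtains C :: "nat \<Rightarrow> (nat \<Rightarrow> bool) set" where
    "\<And>P. {n. P n} \<in> I \<longleftrightarrow> (\<exists>k. P \<in> C k)" "\<And>k. closed (C k)"
proof -
  have "\<exists>C. (\<lambda>A n. n \<in> A) ` I = (\<Union>k :: nat. C k) \<and> (\<forall>k. closed (C k))"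
    using assms by (simp only: fsigma.simps)
  then obtain C where C: "(\<lambda>A n. n \<in> A) ` I = (\<Union>k :: nat. C k)" "\<forall>k. closed (C k)"
    by (elim exE conjE)
  have "{n. P n} \<in> I \<longleftrightarrow> (\<exists>k. P \<in> C k)" for P
    unfolding char_fun_image_iff[symmetric] C(1) by simp
  then show thesis by (rule that) (simp add: C(2))
qed

text \<open>The set is again F-sigma: it is the preimage of \<open>I\<close> under the continuous
  map sending \<open>w\<close> to the characteristic function of
  \<open>differ w z - {..<N}\<close>.\<close>

lemma differ_ideal_borel:
  assumes "fsigma ((\<lambda>A n. n \<in> A) ` I)"
  shows "{w. differ w z - {..<N} \<in> I} \<in> sets borel"
proof -
  obtain C :: "nat \<Rightarrow> (nat \<Rightarrow> bool) set" where
    C: "\<And>P. {n. P n} \<in> I \<longleftrightarrow> (\<exists>k. P \<in> C k)" "\<And>k. closed (C k)"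
    using fsigma_idealE[OF assms] by metis
  let ?h = "\<lambda>(w :: nat \<Rightarrow> bool) n. w n \<noteq> z n \<and> N \<le> n"
  have h: "continuous_on UNIV ?h"
  proof (rule continuous_on_coordinatewise_then_product)
    fix n
    have "continuous_on UNIV ((\<lambda>b. b \<noteq> z n \<and> N \<le> n) \<circ> (\<lambda>w :: nat \<Rightarrow> bool. w n))"
      by (rule continuous_on_compose) (simp_all add: continuous_on_discrete)
    then show "continuous_on UNIV (\<lambda>w. ?h w n)" by (simp add: o_def)
  qed
  have "differ w z - {..<N} \<in> I \<longleftrightarrow> (\<exists>k. ?h w \<in> C k)" for w
  proof -
    have "differ w z - {..<N} = {n. ?h w n}" by auto
    then show ?thesis by (simp only: C(1))
  qed
  then have "{w. differ w z - {..<N} \<in> I} = (\<Union>k. ?h -` C k)" by auto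
  also have "\<dots> \<in> sets borel"
    using closed_vimage[OF C(2) h] by (intro sets.countable_UN) (auto simp: borel_closed)
  finally show ?thesis .
qed

section \<open>Deciding the values of a reduction and finding limits at nodes\<close>

locale laver_reduction =
  fixes T :: "nat list set" and I :: "nat set set" and f :: "(nat \<Rightarrow> nat) \<Rightarrow> nat \<Rightarrow> bool"
  assumes fsigma: "fsigma_ideal I"
    and f_measurable: "f \<in> measurable (branch_space T) borel"
begin

lemma ideal: "is_ideal I"
  using fsigma by (simp add: fsigma_ideal_def)

lemma decide_coordinate:
  assumes "laver_at t U" "U \<subseteq> T"
  shows "\<exists>V\<subseteq>U. laver_at t V \<and> (\<exists>b. \<forall>x\<in>branches V. f x k = b)"
proof -
  obtain V where "V \<subseteq> U" "laver_at t V"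
    "(\<forall>x\<in>branches V. f x \<in> {w. w k}) \<or> (\<forall>x\<in>branches V. f x \<notin> {w. w k})"
    using borel_function_decided[OF f_measurable[unfolded branch_space_def] coordinate_borel assms] .
  then show ?thesis by (intro exI[of _ V]) auto
qed

lemma decide_ideal:
  assumes "laver_at t U" "U \<subseteq> T"
  obtains V where "V \<subseteq> U" "laver_at t V"
    "(\<forall>x\<in>branches V. differ (f x) z - {..<N} \<in> I) \<or> (\<forall>x\<in>branches V. differ (f x) z - {..<N} \<notin> I)"
proof -
  have "{w. differ w z - {..<N} \<in> I} \<in> sets borel"
    using fsigma by (intro differ_ideal_borel) (simp add: fsigma_ideal_def)
  from borel_function_decided[OF f_measurable[unfolded branch_space_def] this assms]
  show thesis using that by auto
qed

text \<open>Coordinates are decided one after another on shrinking trees with stem \<open>t\<close>.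
  The result is a decreasing sequence because its intersection need not be a Laver tree.\<close>

lemma decide_initial:
  assumes U: "laver_at t U" "U \<subseteq> T"
  obtains V g where "\<And>k. laver_at t (V k)" "\<And>k. V k \<subseteq> U" "decseq V"
    "\<And>k i x. x \<in> branches (V k) \<Longrightarrow> i < k \<Longrightarrow> f x i = g i"
proof -
  have "\<exists>V. \<forall>n. (laver_at t (V n) \<and> V n \<subseteq> U) \<and> (V (Suc n) \<subseteq> V n \<and> (\<exists>b. \<forall>x\<in>branches (V (Suc n)). f x n = b))"
  proof (rule dependent_nat_choice)
    show "\<exists>V. laver_at t V \<and> V \<subseteq> U" using U by blast
  next
    fix V n assume V: "laver_at t V \<and> V \<subseteq> U"
    with U have "\<exists>W\<subseteq>V. laver_at t W \<and> (\<exists>b. \<forall>x\<in>branches W. f x n = b)"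
      by (intro decide_coordinate) auto
    with V show "\<exists>W. (laver_at t W \<and> W \<subseteq> U) \<and> W \<subseteq> V \<and> (\<exists>b. \<forall>x\<in>branches W. f x n = b)"
      by (meson subset_trans)
  qed
  then obtain V where V: "\<And>n. laver_at t (V n)" "\<And>n. V n \<subseteq> U" "\<And>n. V (Suc n) \<subseteq> V n"
    and "\<forall>n. \<exists>b. \<forall>x\<in>branches (V (Suc n)). f x n = b"
    by blast
  then obtain g where g: "\<And>n x. x \<in> branches (V (Suc n)) \<Longrightarrow> f x n = g n" by metis
  have dec: "decseq V" using V(3) by (rule decseq_SucI)
  have "f x i = g i" if "x \<in> branches (V k)" "i < k" for k i x
  proof -
    have "x \<in> branches (V (Suc i))" using branches_mono[OF decseqD[OF dec, of "Suc i" k]] that by auto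
    then show ?thesis by (rule g)
  qed
  then show thesis by (rule that[OF V(1,2) dec])
qed

text \<open>Deciding the first \<open>N\<close> coordinates makes all values agree below
  \<open>N\<close>; from \<open>N\<close> on, two values are compared through
  \<open>z\<close>.\<close>

lemma equivalent_subtree:
  assumes U: "laver_at t U" "U \<subseteq> T" and z: "\<And>x. x \<in> branches U \<Longrightarrow> differ (f x) z - {..<N} \<in> I"
  shows "\<exists>S\<subseteq>U. laver_at t S \<and> (\<forall>x\<in>branches S. \<forall>y\<in>branches S. differ (f x) (f y) \<in> I)"
proof -
  from decide_initial[OF U] obtain V g where V: "\<And>k. laver_at t (V k)" "\<And>k. V k \<subseteq> U"
    "\<And>k i x. x \<in> branches (V k) \<Longrightarrow> i < k \<Longrightarrow> f x i = g i"
    by metis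
  have "differ (f x) (f y) \<in> I" if xy: "x \<in> branches (V N)" "y \<in> branches (V N)" for x y
  proof -
    have "x \<in> branches U" "y \<in> branches U" using xy branches_mono[OF V(2)] by auto
    then have "(differ (f x) z - {..<N}) \<union> (differ (f y) z - {..<N}) \<in> I"
      by (intro ideal_Un[OF ideal] z)
    moreover have "differ (f x) (f y) \<subseteq> (differ (f x) z - {..<N}) \<union> (differ (f y) z - {..<N})"
      using V(3)[OF xy(1)] V(3)[OF xy(2)] by (auto simp: not_less[symmetric])
    ultimately show ?thesis by (rule ideal_subset[OF ideal])
  qed
  with V show ?thesis by (intro exI[of _ "V N"]) simp
qed

text \<open>Initial segments are removed because an ideal need not contain the finite sets.\<close>

definition limit_at :: "nat list \<Rightarrow> nat list set \<Rightarrow> (nat \<Rightarrow> bool) \<Rightarrow> bool" where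
  "limit_at t V g \<longleftrightarrow> (\<forall>x\<in>branches V. \<forall>N. differ (f x) g - {..<N} \<notin> I) \<and>
     (\<forall>k. \<exists>m. \<forall>n\<ge>m. \<forall>x\<in>branches V. seg x (Suc (length t)) = t @ [n] \<longrightarrow> (\<forall>i<k. f x i = g i))"

lemma limit_at_mono:
  assumes "limit_at t V g" "W \<subseteq> V"
  shows "limit_at t W g"
proof -
  have sub: "branches W \<subseteq> branches V" using assms(2) by (rule branches_mono)
  show ?thesis
    unfolding limit_at_def
  proof (intro conjI ballI allI)
    show "differ (f x) g - {..<N} \<notin> I" if "x \<in> branches W" for x N
      using assms(1) that sub unfolding limit_at_def by auto
  next
    fix k
    obtain m where "\<forall>n\<ge>m. \<forall>x\<in>branches V. seg x (Suc (length t)) = t @ [n] \<longrightarrow> (\<forall>i<k. f x i = g i)"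
      using assms(1) unfolding limit_at_def by blast
    with sub show "\<exists>m. \<forall>n\<ge>m. \<forall>x\<in>branches W. seg x (Suc (length t)) = t @ [n] \<longrightarrow> (\<forall>i<k. f x i = g i)"
      by (intro exI[of _ m]) blast
  qed
qed

text \<open>The limit \<open>g\<close> is the sequence of decided coordinates. Keeping only
  \<open>V k\<close> above the \<open>k\<close>-th chosen child of \<open>t\<close> makes
  \<open>f\<close> follow \<open>g\<close> up to \<open>k\<close> there. A further shrinking removes
  the branches whose value is equivalent to \<open>g\<close> from some position on.\<close>

lemma node_limit:
  assumes no_class: "\<And>t U z N. laver_at t U \<Longrightarrow> U \<subseteq> T \<Longrightarrow>
      \<exists>x\<in>branches U. differ (f x) z - {..<N} \<notin> I"
    and U: "laver_at t U" "U \<subseteq> T"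
  shows "\<exists>V\<subseteq>U. laver_at t V \<and> (\<exists>g. limit_at t V g)"
proof -
  from decide_initial[OF U] obtain V g where V: "\<And>k. laver_at t (V k)" "\<And>k. V k \<subseteq> U" "decseq V"
    "\<And>k i x. x \<in> branches (V k) \<Longrightarrow> i < k \<Longrightarrow> f x i = g i"
    by metis
  \<comment> \<open>The labels \<open>n k\<close> increase strictly, so a child with label at least
    \<open>n k\<close> was chosen at step \<open>k\<close> or later.\<close>
  have "\<exists>n. \<forall>k. t @ [n k] \<in> V k \<and> n k < n (Suc k)"
  proof (rule dependent_nat_choice)
    show "\<exists>n. t @ [n] \<in> V 0"
      using laver_atD(2,4)[OF V(1)] not_finite_existsD by fastforce
  next
    fix n k
    have "infinite {n. t @ [n] \<in> V (Suc k)}" using laver_atD(2,4)[OF V(1)] by simp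
    then obtain m where "m > n" "t @ [m] \<in> V (Suc k)" unfolding infinite_nat_iff_unbounded by blast
    then show "\<exists>m. t @ [m] \<in> V (Suc k) \<and> n < m" by blast
  qed
  then obtain n where n: "\<And>k. t @ [n k] \<in> V k" "strict_mono n" by (auto simp: strict_mono_Suc_iff)
  define A where "A = range n"
  \<comment> \<open>For a chosen label \<open>i\<close>, \<open>inv n i\<close> is the step at which
    it was chosen.\<close>
  define W where "W i = restr (V (inv n i)) (t @ [i])" for i
  have inj: "inj n" using n(2) by (rule strict_mono_imp_inj_on)
  have W: "laver_at (t @ [i]) (W i)" if "i \<in> A" for i
    using that n(1) inj unfolding A_def W_def by (auto intro!: laver_at_restr[OF V(1)])
  have sub: "(\<Union>i\<in>A. W i) \<subseteq> U" using V(2) restr_subset unfolding W_def by blast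
  have L: "laver_at t (\<Union>i\<in>A. W i)"
  proof (rule laver_at_amalgamate)
    show "infinite A" unfolding A_def using inj by (rule range_inj_infinite)
  qed (rule W)
  have lim: "f x i = g i" if x: "x \<in> branches (\<Union>i\<in>A. W i)" "seg x (Suc (length t)) = t @ [m]"
    "m \<ge> n k" "i < k" for x m k i
  proof -
    from branches_amalgamate[OF W x(1)] obtain a where a: "a \<in> A" "seg x (Suc (length t)) = t @ [a]" "x \<in> branches (W a)"
      by blast
    with x(2) have "a = m" by (metis append1_eq_conv)
    with a(1) obtain j where j: "m = n j" unfolding A_def by blast
    have "j \<ge> k" using x(3) n(2) unfolding j by (simp add: strict_mono_less_eq)
    moreover have "x \<in> branches (V j)"
      using a(3) inj branches_mono[OF restr_subset] unfolding \<open>a = m\<close> j W_def by fastforce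
    ultimately show ?thesis using V(4) x(4) by simp
  qed
  \<comment> \<open>One Borel set for each \<open>N\<close>; on a deciding subtree
    \<open>no_class\<close> rules out the positive answer.\<close>
  have "\<exists>S\<subseteq>(\<Union>i\<in>A. W i). laver_at t S \<and> (\<forall>N. branches S \<inter> {x. differ (f x) g - {..<N} \<in> I} = {})"
  proof (rule laver_avoid_countable[OF L])
    fix N u Y assume Y: "laver_at u Y" "Y \<subseteq> (\<Union>i\<in>A. W i)"
    then have YT: "Y \<subseteq> T" using sub U(2) by blast
    obtain Z where Z: "Z \<subseteq> Y" "laver_at u Z"
      "(\<forall>x\<in>branches Z. differ (f x) g - {..<N} \<in> I) \<or> (\<forall>x\<in>branches Z. differ (f x) g - {..<N} \<notin> I)"
      using decide_ideal[OF Y(1) YT] .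
    with no_class[OF Z(2), of g N] YT show
      "\<exists>V\<subseteq>Y. laver_at u V \<and> branches V \<inter> {x. differ (f x) g - {..<N} \<in> I} = {}"
      by (intro exI[of _ Z]) auto
  qed
  then obtain S where S: "S \<subseteq> (\<Union>i\<in>A. W i)" "laver_at t S"
    "\<forall>N. branches S \<inter> {x. differ (f x) g - {..<N} \<in> I} = {}" by blast
  have "limit_at t S g"
    unfolding limit_at_def
  proof (intro conjI ballI allI)
    show "differ (f x) g - {..<N} \<notin> I" if "x \<in> branches S" for x N using S(3) that by blast
  next
    fix k
    show "\<exists>m. \<forall>n\<ge>m. \<forall>x\<in>branches S. seg x (Suc (length t)) = t @ [n] \<longrightarrow> (\<forall>i<k. f x i = g i)"
      using lim branches_mono[OF S(1)] by (intro exI[of _ "n k"]) blast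
  qed
  with S sub show ?thesis by blast
qed

text \<open>Fusion of \<open>node_limit\<close>, whose conclusion is hereditary. The limits obtained
  for \<open>restr S t\<close> serve for \<open>S\<close> because a branch of \<open>S\<close>
  through \<open>t\<close> is a branch of that cone.\<close>

lemma limit_tree:
  assumes no_class: "\<And>t U z N. laver_at t U \<Longrightarrow> U \<subseteq> T \<Longrightarrow>
      \<exists>x\<in>branches U. differ (f x) z - {..<N} \<notin> I"
    and T: "laver_at s T"
  obtains S g where "S \<subseteq> T" "laver_at s S"
    "\<And>t x N. t \<in> S \<Longrightarrow> prefix s t \<Longrightarrow> x \<in> branches S \<Longrightarrow> seg x (length t) = t \<Longrightarrow>
       differ (f x) (g t) - {..<N} \<notin> I"
    "\<And>t k. t \<in> S \<Longrightarrow> prefix s t \<Longrightarrow>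
       \<exists>m. \<forall>n\<ge>m. \<forall>x\<in>branches S. seg x (Suc (length t)) = t @ [n] \<longrightarrow> (\<forall>i<k. f x i = g t i)"
proof -
  obtain S where S: "S \<subseteq> T" "laver_at s S"
    "\<And>t. t \<in> S \<Longrightarrow> prefix s t \<Longrightarrow> \<exists>g. limit_at t (restr S t) g"
  proof (rule laver_fusion[OF T, where Q = "\<lambda>t V. \<exists>g. limit_at t V g"])
    show "\<exists>V\<subseteq>U. laver_at t V \<and> (\<exists>g. limit_at t V g)" if "laver_at t U" "U \<subseteq> T" for t U
      using no_class that by (rule node_limit)
  next
    show "\<exists>g. limit_at t W g" if "\<exists>g. limit_at t V g" "W \<subseteq> V" for t V W
      using that limit_at_mono by blast
  qed blast
  then obtain g where g: "\<And>t. t \<in> S \<Longrightarrow> prefix s t \<Longrightarrow> limit_at t (restr S t) (g t)" by metis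
  show thesis
  proof (rule that[OF S(1,2)])
    fix t x N assume "t \<in> S" "prefix s t" "x \<in> branches S" "seg x (length t) = t"
    then show "differ (f x) (g t) - {..<N} \<notin> I"
      using g branch_restr unfolding limit_at_def by blast
  next
    fix t k assume t: "t \<in> S" "prefix s t"
    then obtain m where m: "\<And>n x. n \<ge> m \<Longrightarrow> x \<in> branches (restr S t) \<Longrightarrow>
        seg x (Suc (length t)) = t @ [n] \<Longrightarrow> \<forall>i<k. f x i = g t i"
      using g unfolding limit_at_def by blast
    have "seg x (length t) = t" if "seg x (Suc (length t)) = t @ [n]" for x n
      using that by simp
    with m show "\<exists>m. \<forall>n\<ge>m. \<forall>x\<in>branches S. seg x (Suc (length t)) = t @ [n] \<longrightarrow> (\<forall>i<k. f x i = g t i)"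
      using branch_restr by blast
  qed
qed

end

section \<open>A tree whose branches are pairwise inequivalent\<close>

text \<open>Summing over all nodes enumerated so far makes the bound of a stage monotone in the stage.\<close>

definition stage_bound :: "(nat list \<Rightarrow> nat list \<Rightarrow> nat \<Rightarrow> nat) \<Rightarrow> (nat \<Rightarrow> nat list) \<Rightarrow> nat \<Rightarrow> nat" where
  "stage_bound b \<sigma> j = j + (\<Sum>(i, i', k)\<in>{..j} \<times> {..j} \<times> {..j}. b (\<sigma> i) (\<sigma> i') k)"

lemma stage_bound_cong:
  assumes "\<And>i. i \<le> j \<Longrightarrow> \<sigma> i = \<tau> i"
  shows "stage_bound b \<sigma> j = stage_bound b \<tau> j"
proof -
  have "(\<Sum>(i, i', k)\<in>{..j} \<times> {..j} \<times> {..j}. b (\<sigma> i) (\<sigma> i') k) =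
      (\<Sum>(i, i', k)\<in>{..j} \<times> {..j} \<times> {..j}. b (\<tau> i) (\<tau> i') k)"
    by (rule sum.cong) (auto simp: assms)
  then show ?thesis by (simp only: stage_bound_def)
qed

lemma stage_bound_mono: "i \<le> j \<Longrightarrow> stage_bound b \<sigma> i \<le> stage_bound b \<sigma> j"
  unfolding stage_bound_def by (rule add_mono, assumption, rule sum_mono2) auto

lemma stage_bound_ge: "j \<le> stage_bound b \<sigma> j"
  by (simp add: stage_bound_def)

lemma le_stage_bound:
  assumes "i \<le> j" "i' \<le> j" "k \<le> j"
  shows "b (\<sigma> i) (\<sigma> i') k \<le> stage_bound b \<sigma> j"
proof -
  have "(\<lambda>(i, i', k). b (\<sigma> i) (\<sigma> i') k) (i, i', k) \<le>
      (\<Sum>(i, i', k)\<in>{..j} \<times> {..j} \<times> {..j}. b (\<sigma> i) (\<sigma> i') k)"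
    by (rule member_le_sum) (use assms in auto)
  then show ?thesis by (simp add: stage_bound_def)
qed

section \<open>A subtree enumerated in stages\<close>

lemma fst_prod_decode_le: "fst (prod_decode j) \<le> j"
  using le_prod_encode_1[of "fst (prod_decode j)" "snd (prod_decode j)"] by simp

lemma infinite_fst_prod_decode: "infinite {j. fst (prod_decode j) = i}"
proof
  assume "finite {j. fst (prod_decode j) = i}"
  moreover have "range (\<lambda>k. prod_encode (i, k)) \<subseteq> {j. fst (prod_decode j) = i}" by auto
  ultimately have "finite (range (\<lambda>k. prod_encode (i, k)))" by (rule rev_finite_subset)
  moreover have "inj (\<lambda>k. prod_encode (i, k))" by (simp add: inj_on_def prod_encode_eq)
  ultimately show False using finite_imageD by blast
qed

text \<open>\<open>p j\<close> is the index of the parent of \<open>\<sigma> (Suc j)\<close>, and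
  \<open>p_inf\<close> gives every node infinitely many turns as a parent.
  \<open>stage_bound b \<sigma> j\<close> depends only on
  \<open>\<sigma> 0, ..., \<sigma> j\<close>, so it is known when \<open>\<sigma> (Suc j)\<close> is
  chosen far enough out to satisfy \<open>follow\<close>.\<close>

locale enumerated_tree =
  fixes s :: "nat list" and S :: "nat list set" and \<sigma> :: "nat \<Rightarrow> nat list" and p :: "nat \<Rightarrow> nat"
    and f :: "(nat \<Rightarrow> nat) \<Rightarrow> nat \<Rightarrow> bool" and g :: "nat list \<Rightarrow> nat \<Rightarrow> bool"
    and b :: "nat list \<Rightarrow> nat list \<Rightarrow> nat \<Rightarrow> nat"
  assumes S: "laver_at s S"
    and zero: "\<sigma> 0 = s" and mem: "\<sigma> j \<in> S" and stem: "prefix s (\<sigma> j)" and inj: "inj \<sigma>"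
    and p_le: "p j \<le> j" and p_inf: "infinite {j. p j = i}"
    and child: "\<exists>m. \<sigma> (Suc j) = \<sigma> (p j) @ [m]"
    and follow: "x \<in> branches S \<Longrightarrow> seg x (length (\<sigma> (Suc j))) = \<sigma> (Suc j) \<Longrightarrow>
      i < stage_bound b \<sigma> j \<Longrightarrow> f x i = g (\<sigma> (p j)) i"

text \<open>Each new child has to avoid only finitely many labels: those below the threshold from
  \<open>lim\<close> and those of nodes already used. Pair decoding serves as the bookkeeping of
  parents.\<close>

lemma enumerated_tree_exists:
  assumes S: "laver_at s S"
    and lim: "\<And>t k. t \<in> S \<Longrightarrow> prefix s t \<Longrightarrow>
      \<exists>m. \<forall>n\<ge>m. \<forall>x\<in>branches S. seg x (Suc (length t)) = t @ [n] \<longrightarrow> (\<forall>i<k. f x i = g t i)"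
  shows "\<exists>\<sigma>. enumerated_tree s S \<sigma> (\<lambda>j. fst (prod_decode j)) f g b"
proof -
  define p where "p j = fst (prod_decode j)" for j
  have p_le: "p j \<le> j" for j by (simp add: p_def fst_prod_decode_le)
  define P where "P \<sigma> j r \<longleftrightarrow> r \<in> S \<and> prefix s r \<and> r \<notin> \<sigma> ` {..<j} \<and>
    (case j of 0 \<Rightarrow> r = s | Suc i \<Rightarrow> (\<exists>m. r = \<sigma> (p i) @ [m]) \<and>
      (\<forall>x\<in>branches S. seg x (length r) = r \<longrightarrow> (\<forall>n<stage_bound b \<sigma> i. f x n = g (\<sigma> (p i)) n)))"
    for \<sigma> :: "nat \<Rightarrow> nat list" and j r
  have "\<exists>\<sigma>. \<forall>j. P \<sigma> j (\<sigma> j)"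
  \<comment> \<open>The condition at \<open>j\<close> depends on \<open>\<sigma>\<close> below
    \<open>j\<close> only; for the parent at a successor stage this is
    \<open>p i \<le> i\<close>.\<close>
  proof (rule dependent_wellorder_choice)
    fix r j and \<sigma> \<tau> :: "nat \<Rightarrow> nat list"
    assume eq: "\<And>i. i < j \<Longrightarrow> \<sigma> i = \<tau> i"
    have "\<sigma> ` {..<j} = \<tau> ` {..<j}" using eq by auto
    moreover have "\<sigma> (p i) = \<tau> (p i)" "stage_bound b \<sigma> i = stage_bound b \<tau> i" if "j = Suc i" for i
      using that eq p_le[of i] by (auto intro: stage_bound_cong)
    ultimately show "P \<sigma> j r = P \<tau> j r" unfolding P_def by (cases j) simp_all
  next
    fix j and \<sigma> :: "nat \<Rightarrow> nat list"
    assume IH: "\<And>i. i < j \<Longrightarrow> P \<sigma> i (\<sigma> i)"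
    show "\<exists>r. P \<sigma> j r"
    proof (cases j)
      case 0
      then have "P \<sigma> j s" using laver_atD(2)[OF S] by (simp add: P_def)
      then show ?thesis ..
    next
      case (Suc i)
      let ?t = "\<sigma> (p i)"
      have "p i < j" using p_le[of i] Suc by simp
      then have t: "?t \<in> S" "prefix s ?t" using IH[of "p i"] by (simp_all add: P_def)
      obtain m where m: "\<And>n x. n \<ge> m \<Longrightarrow> x \<in> branches S \<Longrightarrow> seg x (Suc (length ?t)) = ?t @ [n] \<Longrightarrow>
          \<forall>l<stage_bound b \<sigma> i. f x l = g ?t l"
        using lim[OF t, of "stage_bound b \<sigma> i"] by blast
      have "finite ({..<m} \<union> {n. ?t @ [n] \<in> \<sigma> ` {..<j}})"
      proof (rule finite_UnI)
        have "finite ((\<lambda>n. ?t @ [n]) -` (\<sigma> ` {..<j}))" by (rule finite_vimageI) (auto simp: inj_on_def)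
        then show "finite {n. ?t @ [n] \<in> \<sigma> ` {..<j}}" by (simp add: vimage_def)
      qed simp
      then have "infinite ({n. ?t @ [n] \<in> S} - ({..<m} \<union> {n. ?t @ [n] \<in> \<sigma> ` {..<j}}))"
        using laver_atD(4)[OF S t] by (rule Diff_infinite_finite)
      then have "{n. ?t @ [n] \<in> S} - ({..<m} \<union> {n. ?t @ [n] \<in> \<sigma> ` {..<j}}) \<noteq> {}"
        by (rule infinite_imp_nonempty)
      then obtain n where n: "n \<in> {n. ?t @ [n] \<in> S} - ({..<m} \<union> {n. ?t @ [n] \<in> \<sigma> ` {..<j}})"
        by blast
      then have "P \<sigma> j (?t @ [n])"
        using t(2) m[of n] unfolding P_def Suc by (simp del: upt_Suc)
      then show ?thesis ..
    qed
  qed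
  then obtain \<sigma> where \<sigma>: "\<And>j. P \<sigma> j (\<sigma> j)" by blast
  have "enumerated_tree s S \<sigma> p f g b"
  proof
    show "laver_at s S" by (rule S)
    show "\<sigma> 0 = s" using \<sigma>[of 0] by (simp add: P_def)
    show "\<sigma> j \<in> S" "prefix s (\<sigma> j)" for j using \<sigma>[of j] by (simp_all add: P_def)
    show "inj \<sigma>"
    proof (rule injI, rule ccontr)
      fix i j assume eq: "\<sigma> i = \<sigma> j" and "i \<noteq> j"
      have "\<sigma> j \<notin> \<sigma> ` {..<j}" "\<sigma> i \<notin> \<sigma> ` {..<i}" using \<sigma>[of j] \<sigma>[of i] by (simp_all add: P_def)
      with \<open>i \<noteq> j\<close> eq show False by (metis imageI lessThan_iff linorder_neqE_nat)
    qed
    show "p j \<le> j" for j by (rule p_le)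
    show "infinite {j. p j = i}" for i unfolding p_def by (rule infinite_fst_prod_decode)
    show "\<exists>m. \<sigma> (Suc j) = \<sigma> (p j) @ [m]" for j using \<sigma>[of "Suc j"] by (simp add: P_def)
    show "f x i = g (\<sigma> (p j)) i" if "x \<in> branches S" "seg x (length (\<sigma> (Suc j))) = \<sigma> (Suc j)"
      "i < stage_bound b \<sigma> j" for x j i
      using \<sigma>[of "Suc j"] that by (simp add: P_def)
  qed
  then show ?thesis unfolding p_def by blast
qed

context enumerated_tree
begin

definition tree :: "nat list set" where
  "tree = {u. \<exists>j. prefix u (\<sigma> j)}"

lemma tree_subset: "tree \<subseteq> S"
  using laver_atD(1)[OF S mem] by (auto simp: tree_def)

text \<open>Since every parent is itself enumerated, closing under prefixes adds no node above the
  stem.\<close>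

lemma tree_range:
  assumes "u \<in> tree" "prefix s u"
  shows "u \<in> range \<sigma>"
proof -
  from assms(1) obtain j where "prefix u (\<sigma> j)" by (auto simp: tree_def)
  then show ?thesis
  proof (induction j rule: less_induct)
    case (less j)
    show ?case
    proof (cases j)
      case 0
      with less.prems assms(2) have "u = \<sigma> 0" using prefix_order.antisym by (simp add: zero)
      then show ?thesis by blast
    next
      case (Suc i)
      obtain m where m: "\<sigma> (Suc i) = \<sigma> (p i) @ [m]" using child by blast
      from less.prems consider "prefix u (\<sigma> (p i))" | "u = \<sigma> (Suc i)"
        unfolding Suc m prefix_snoc by blast
      then show ?thesis
      proof cases
        case 1
        then show ?thesis using less.IH[of "p i"] p_le[of i] Suc by simp
      qed blast
    qed
  qed
qed

lemma laver_at_tree: "laver_at s tree"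
proof (rule laver_atI)
  show "u \<in> tree" if "t \<in> tree" "prefix u t" for t u
    using that prefix_order.trans unfolding tree_def by blast
  show "s \<in> tree" using zero unfolding tree_def by (metis mem_Collect_eq prefix_order.refl)
  show "prefix s t \<or> prefix t s" if "t \<in> tree" for t
    using that tree_subset laver_atD(3)[OF S] by blast
  fix t assume "t \<in> tree" "prefix s t"
  then obtain i where i: "t = \<sigma> i" using tree_range by blast
  obtain m where m: "\<And>j. \<sigma> (Suc j) = \<sigma> (p j) @ [m j]" using child by metis
  \<comment> \<open>Injectivity of \<open>\<sigma>\<close> turns infinitely many turns of the parent
    \<open>\<sigma> i\<close> into infinitely many distinct children.\<close>
  have "inj_on m {j. p j = i}"
  proof (rule inj_onI)
    fix j k assume "j \<in> {j. p j = i}" "k \<in> {j. p j = i}" "m j = m k"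
    then have "\<sigma> (Suc j) = \<sigma> (Suc k)" by (simp add: m)
    then show "j = k" using inj by (simp add: inj_eq)
  qed
  then have "infinite (m ` {j. p j = i})" using p_inf finite_imageD by blast
  moreover have "m ` {j. p j = i} \<subseteq> {n. t @ [n] \<in> tree}"
  proof
    fix n assume "n \<in> m ` {j. p j = i}"
    then obtain j where "t @ [n] = \<sigma> (Suc j)" using i m by auto
    then have "prefix (t @ [n]) (\<sigma> (Suc j))" by simp
    then show "n \<in> {n. t @ [n] \<in> tree}" unfolding tree_def by blast
  qed
  ultimately show "infinite {n. t @ [n] \<in> tree}" using finite_subset by blast
qed

lemma branch_node:
  assumes "x \<in> branches tree" "length s \<le> n"
  shows "seg x n \<in> range \<sigma>"
proof (rule tree_range)
  show "seg x n \<in> tree" using assms(1) by (rule branchesD)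
  show "prefix s (seg x n)"
    using prefix_seg_seg[OF assms(2)] branch_extends_stem[OF laver_at_tree assms(1)] by metis
qed

text \<open>\<open>X j\<close> is the longest initial segment of \<open>x\<close> that is a node by stage \<open>j\<close>.\<close>

lemma branch_stages:
  assumes x: "x \<in> branches tree"
  obtains X where "\<And>j. X j \<in> \<sigma> ` {..j}" "\<And>j. seg x (length (X j)) = X j"
    "\<And>i j. i < stage_bound b \<sigma> j \<Longrightarrow> f x i = g (X j) i"
    "\<And>j. seg x (length (\<sigma> (Suc j))) \<noteq> \<sigma> (Suc j) \<Longrightarrow> X (Suc j) = X j"
proof -
  define A where "A j = {n. seg x n \<in> \<sigma> ` {..j}}" for j
  define L where "L j = Max (A j)" for j
  have fin: "finite (A j)" for j
  proof (rule finite_subset)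
    show "A j \<subseteq> length ` \<sigma> ` {..j}"
    proof
      fix n assume "n \<in> A j"
      then have "length (seg x n) \<in> length ` \<sigma> ` {..j}" unfolding A_def by blast
      then show "n \<in> length ` \<sigma> ` {..j}" by simp
    qed
  qed simp
  have "seg x (length s) = \<sigma> 0" using branch_extends_stem[OF laver_at_tree x] zero by simp
  then have s_A: "length s \<in> A j" for j unfolding A_def by auto
  have L_A: "L j \<in> A j" for j unfolding L_def using fin s_A by (intro Max_in) auto
  have L_max: "n \<le> L j" if "n \<in> A j" for n j unfolding L_def using fin that by (rule Max_ge)
  define X where "X j = seg x (L j)" for j
  show thesis
  proof (rule that[of X])
    show "X j \<in> \<sigma> ` {..j}" for j using L_A unfolding X_def A_def by blast
    show "seg x (length (X j)) = X j" for j by (simp add: X_def)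
    show "X (Suc j) = X j" if "seg x (length (\<sigma> (Suc j))) \<noteq> \<sigma> (Suc j)" for j
    proof -
      have "seg x n \<noteq> \<sigma> (Suc j)" for n
      proof
        assume eq: "seg x n = \<sigma> (Suc j)"
        from arg_cong[OF eq, of length] have "length (\<sigma> (Suc j)) = n" by simp
        with that eq show False by simp
      qed
      then have "A (Suc j) = A j" unfolding A_def by (auto simp: atMost_Suc)
      then show ?thesis by (simp add: X_def L_def)
    qed
    fix i j assume i: "i < stage_bound b \<sigma> j"
    have "length s \<le> Suc (L j)" using L_max[OF s_A] by (rule le_SucI)
    \<comment> \<open>\<open>\<sigma> k\<close> is the next node on \<open>x\<close> after
      \<open>X j\<close>. By maximality of \<open>X j\<close> it is enumerated after stage
      \<open>j\<close>, and its parent is \<open>X j\<close>, so \<open>follow\<close> applies with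
      a bound at least that of stage \<open>j\<close>.\<close>
    from branch_node[OF x this] obtain k where k: "\<sigma> k = seg x (Suc (L j))" by (metis imageE)
    have "Suc (L j) \<notin> A j" using L_max[of "Suc (L j)" j] by auto
    then have "j < k" using k unfolding A_def by (metis (mono_tags) atMost_iff image_eqI mem_Collect_eq not_less)
    then obtain k' where k': "k = Suc k'" "j \<le> k'" by (cases k) auto
    obtain m where "\<sigma> (Suc k') = \<sigma> (p k') @ [m]" using child by blast
    then have "\<sigma> (p k') = X j" using k k' by (simp add: X_def)
    moreover have "f x i = g (\<sigma> (p k')) i"
    proof (rule follow)
      show "x \<in> branches S" using x branches_mono[OF tree_subset] by blast
      have "length (\<sigma> (Suc k')) = Suc (L j)" using k k' by simp
      then show "seg x (length (\<sigma> (Suc k'))) = \<sigma> (Suc k')" using k k' by metis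
      show "i < stage_bound b \<sigma> k'" using i stage_bound_mono[OF k'(2)] by (rule less_le_trans)
    qed
    ultimately show "f x i = g (X j) i" by simp
  qed
qed

lemma branches_inequivalent:
  assumes ideal: "is_ideal I" and B: "B \<in> I"
    and C: "\<And>A. A \<in> I \<Longrightarrow> \<exists>k. (\<lambda>n. n \<in> A) \<in> C k"
    and equiv: "\<And>t u k n. differ (g t) (g u) \<in> I \<Longrightarrow> b t u k \<le> n \<Longrightarrow> n \<notin> B \<Longrightarrow> g t n = g u n"
    and inequiv: "\<And>t u k A. differ (g t) (g u) \<notin> I \<Longrightarrow>
      (\<And>n. n < b t u k \<Longrightarrow> n \<in> A \<longleftrightarrow> g t n \<noteq> g u n) \<Longrightarrow> (\<lambda>n. n \<in> A) \<notin> C k"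
    and limit: "\<And>t x N. t \<in> S \<Longrightarrow> prefix s t \<Longrightarrow> x \<in> branches S \<Longrightarrow> seg x (length t) = t \<Longrightarrow>
       differ (f x) (g t) - {..<N} \<notin> I"
    and x: "x \<in> branches tree" and y: "y \<in> branches tree" and neq: "x \<noteq> y"
  shows "differ (f x) (f y) \<notin> I"
proof
  let ?N = "stage_bound b \<sigma>"
  assume D: "differ (f x) (f y) \<in> I"
  from branch_stages[OF x] obtain X where X: "\<And>j. X j \<in> \<sigma> ` {..j}" "\<And>j. seg x (length (X j)) = X j"
    "\<And>i j. i < ?N j \<Longrightarrow> f x i = g (X j) i"
    "\<And>j. seg x (length (\<sigma> (Suc j))) \<noteq> \<sigma> (Suc j) \<Longrightarrow> X (Suc j) = X j" by blast
  from branch_stages[OF y] obtain Y where Y: "\<And>j. Y j \<in> \<sigma> ` {..j}" "\<And>j. seg y (length (Y j)) = Y j"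
    "\<And>i j. i < ?N j \<Longrightarrow> f y i = g (Y j) i"
    "\<And>j. seg y (length (\<sigma> (Suc j))) \<noteq> \<sigma> (Suc j) \<Longrightarrow> Y (Suc j) = Y j" by blast
  have bound: "b t u k \<le> ?N j" if "t \<in> \<sigma> ` {..j}" "u \<in> \<sigma> ` {..j}" "k \<le> j" for t u k j
    using that le_stage_bound by auto
  from C[OF D] obtain k where k: "(\<lambda>n. n \<in> differ (f x) (f y)) \<in> C k" by blast
  \<comment> \<open>Below the bound of stage \<open>j\<close>, \<open>f x\<close> and
    \<open>f y\<close> differ exactly where the two current limits do; were the limits inequivalent,
    this would already exclude \<open>C k\<close>.\<close>
  have eqv: "differ (g (X j)) (g (Y j)) \<in> I" if "k \<le> j" for j
  proof (rule ccontr)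
    assume "differ (g (X j)) (g (Y j)) \<notin> I"
    then have "(\<lambda>n. n \<in> differ (f x) (f y)) \<notin> C k"
    proof (rule inequiv)
      fix n assume "n < b (X j) (Y j) k"
      then have "n < ?N j" using bound[OF X(1) Y(1) that] by simp
      then show "n \<in> differ (f x) (f y) \<longleftrightarrow> g (X j) n \<noteq> g (Y j) n" using X(3) Y(3) by simp
    qed
    with k show False by blast
  qed
  obtain d where d: "x d \<noteq> y d" using neq by blast
  \<comment> \<open>A node on both branches has length at most \<open>d\<close>, and only finitely
    many stages enumerate such a node. From \<open>j0\<close> on, \<open>X\<close> and
    \<open>Y\<close> therefore never move together.\<close>
  have "finite (\<sigma> -` (seg x ` {..d}))" by (rule finite_vimageI) (simp_all add: inj)
  then obtain j1 where j1: "\<And>i. \<sigma> i \<in> seg x ` {..d} \<Longrightarrow> i \<le> j1"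
    using finite_nat_set_iff_bounded_le[of "\<sigma> -` (seg x ` {..d})"] by auto
  define j0 where "j0 = max k j1"
  have step: "X (Suc j) = X j \<or> Y (Suc j) = Y j" if "j0 \<le> j" for j
  proof (rule ccontr)
    assume "\<not> ?thesis"
    then have xy: "seg x (length (\<sigma> (Suc j))) = \<sigma> (Suc j)" "seg y (length (\<sigma> (Suc j))) = \<sigma> (Suc j)"
      using X(4) Y(4) by blast+
    have "length (\<sigma> (Suc j)) \<le> d"
    proof (rule ccontr)
      assume "\<not> ?thesis"
      then have "seg x (length (\<sigma> (Suc j))) ! d = x d" "seg y (length (\<sigma> (Suc j))) ! d = y d"
        by simp_all
      with xy d show False by simp
    qed
    then have "\<sigma> (Suc j) \<in> seg x ` {..d}" using xy(1) by (metis atMost_iff image_eqI)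
    with j1[of "Suc j"] that show False by (simp add: j0_def)
  qed
  let ?a = "X j0"
  \<comment> \<open>The one of \<open>X\<close> and \<open>Y\<close> that rests stays equivalent to
    \<open>g ?a\<close>, and \<open>eqv\<close> carries this over to the one that moved.\<close>
  have conn: "differ (g ?a) (g (X j)) \<in> I \<and> differ (g ?a) (g (Y j)) \<in> I" if "j0 \<le> j" for j
    using that
  proof (induction rule: dec_induct)
    case base
    have "differ (g ?a) (g ?a) \<in> I" using ideal by (simp add: is_ideal_def)
    with eqv[of j0] show ?case by (simp add: j0_def)
  next
    case (step j)
    have e: "differ (g (X (Suc j))) (g (Y (Suc j))) \<in> I" using step.hyps by (intro eqv) (simp add: j0_def)
    then have e': "differ (g (Y (Suc j))) (g (X (Suc j))) \<in> I" by (simp add: eq_commute)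
    from \<open>j0 \<le> j\<close> \<open>\<And>j. j0 \<le> j \<Longrightarrow> X (Suc j) = X j \<or> Y (Suc j) = Y j\<close>
    consider "X (Suc j) = X j" | "Y (Suc j) = Y j" by blast
    then show ?case
    proof cases
      case 1
      then have "differ (g ?a) (g (X (Suc j))) \<in> I" using step.IH by simp
      with differ_trans[OF ideal this e] show ?thesis by blast
    next
      case 2
      then have "differ (g ?a) (g (Y (Suc j))) \<in> I" using step.IH by simp
      with differ_trans[OF ideal this e'] show ?thesis by blast
    qed
  qed
  have "differ (f x) (g ?a) - {..<?N j0} \<subseteq> B \<union> differ (f x) (f y)"
  proof (rule subsetI, rule ccontr)
    fix n assume n: "n \<in> differ (f x) (g ?a) - {..<?N j0}" "n \<notin> B \<union> differ (f x) (f y)"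
    \<comment> \<open>At the preceding stage \<open>j'\<close> the bound is at most
      \<open>n\<close>, so outside \<open>B\<close> both limits agree with \<open>g ?a\<close> at
      \<open>n\<close>. One of \<open>X\<close> and \<open>Y\<close> rests between \<open>j'\<close>
      and \<open>j\<close>, so \<open>f x\<close> or \<open>f y\<close> still has the value
      \<open>g ?a n\<close> at \<open>n\<close>; since \<open>f x n = f y n\<close>, both
      do.\<close>
    define j where "j = (LEAST j. n < ?N j)"
    have "n < ?N (Suc n)" using stage_bound_ge[of "Suc n" b \<sigma>] by simp
    then have j: "n < ?N j" unfolding j_def by (rule LeastI)
    have "j0 < j" using j n(1) stage_bound_mono[of j j0 b \<sigma>] by (auto simp: not_le[symmetric])
    then obtain j' where j': "j = Suc j'" "j0 \<le> j'" by (cases j) auto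
    have "\<not> n < ?N j'" using not_less_Least[of j' "\<lambda>j. n < ?N j"] j'(1) by (simp add: j_def)
    then have le: "?N j' \<le> n" by simp
    have a: "?a \<in> \<sigma> ` {..j'}" using X(1)[of j0] j'(2) by auto
    have gX: "g ?a n = g (X j') n"
      using conn[OF j'(2)] bound[OF a X(1), of 0] le n(2) by (intro equiv[of _ _ 0]) auto
    have gY: "g ?a n = g (Y j') n"
      using conn[OF j'(2)] bound[OF a Y(1), of 0] le n(2) by (intro equiv[of _ _ 0]) auto
    have "f x n = g (X j) n" "f y n = g (Y j) n" using X(3) Y(3) j by blast+
    with step[OF j'(2)] gX gY n show False unfolding j'(1) by auto
  qed
  moreover have "B \<union> differ (f x) (f y) \<in> I" by (rule ideal_Un[OF ideal B D])
  ultimately have "differ (f x) (g ?a) - {..<?N j0} \<in> I" using ideal_subset[OF ideal] by blast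
  moreover obtain i where i: "?a = \<sigma> i" using X(1)[of j0] by blast
  moreover have "x \<in> branches S" using x branches_mono[OF tree_subset] by blast
  ultimately show False using limit[of ?a x] mem[of i] stem[of i] X(2) by metis
qed

end

text \<open>Otherwise members of \<open>C\<close> agreeing with \<open>w\<close> on longer and
  longer initial segments would converge to \<open>w\<close>.\<close>

lemma closed_agreement:
  fixes C :: "(nat \<Rightarrow> bool) set"
  assumes "closed C" "w \<notin> C"
  obtains k where "\<And>v. (\<And>n. n < k \<Longrightarrow> v n = w n) \<Longrightarrow> v \<notin> C"
proof (rule ccontr)
  assume no: "\<not> thesis"
  have "\<exists>v. (\<forall>n<k. v n = w n) \<and> v \<in> C" for k using no that by blast
  then obtain v where v: "\<And>k n. n < k \<Longrightarrow> v k n = w n" "\<And>k. v k \<in> C" by metis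
  have "v \<longlonglongrightarrow> w"
  proof -
    have "(\<lambda>k. v k n) \<longlonglongrightarrow> w n" for n
      by (rule tendsto_eventually) (use v(1) in \<open>auto simp: eventually_sequentially intro!: exI[of _ "Suc n"]\<close>)
    then have "limitin (product_topology (\<lambda>_. euclidean) UNIV) v w sequentially"
      by (simp add: limitin_componentwise)
    then show ?thesis by (simp add: euclidean_product_topology)
  qed
  then have "w \<in> C" by (rule closed_sequentially[OF assms(1), of v, rotated]) (rule v(2))
  with assms(2) show False by contradiction
qed

text \<open>There are only countably many pairs of nodes, so their differences in \<open>I\<close>
  form a sequence, with \<open>{}\<close> in place of a difference outside \<open>I\<close>.\<close>

lemma P_ideal_pseudo_union:
  assumes "P_ideal I"
  obtains B where "B \<in> I" "\<And>t u :: nat list. differ (g t) (g u) \<in> I \<Longrightarrow> finite (differ (g t) (g u) - B)"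
proof -
  have empty: "{} \<in> I" using assms by (simp add: P_ideal_def is_ideal_def)
  define A where "A n = (let (t, u) = from_nat n in
    if differ (g t) (g u) \<in> I then differ (g t) (g u) else {})" for n
  have "A n \<in> I" for n using empty by (simp add: A_def split: prod.split)
  then obtain B where B: "B \<in> I" "\<And>n. finite (A n - B)" using assms unfolding P_ideal_def by blast
  have "finite (differ (g t) (g u) - B)" if "differ (g t) (g u) \<in> I" for t u :: "nat list"
    using B(2)[of "to_nat (t, u)"] that by (simp add: A_def)
  with B(1) show thesis by (rule that)
qed

text \<open>One number serves two purposes. For equivalent limits it lies past the finitely many
  differences outside \<open>B\<close>; for inequivalent limits it is the length of an initial
  segment of their difference that excludes the closed set \<open>C k\<close>.\<close>

lemma agreement_bounds:
  assumes "fsigma_ideal I" "P_ideal I"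
  obtains B C b where "B \<in> I" "\<And>A. A \<in> I \<Longrightarrow> \<exists>k :: nat. (\<lambda>n. n \<in> A) \<in> C k"
    "\<And>t u k n. differ (g t) (g u) \<in> I \<Longrightarrow> b t u k \<le> n \<Longrightarrow> n \<notin> B \<Longrightarrow> g t n = g u n"
    "\<And>(t :: nat list) u k A. differ (g t) (g u) \<notin> I \<Longrightarrow>
      (\<And>n. n < b t u k \<Longrightarrow> n \<in> A \<longleftrightarrow> g t n \<noteq> g u n) \<Longrightarrow> (\<lambda>n. n \<in> A) \<notin> C k"
proof -
  from assms(1) have "fsigma ((\<lambda>A n. n \<in> A) ` I)" by (simp add: fsigma_ideal_def)
  then obtain C :: "nat \<Rightarrow> (nat \<Rightarrow> bool) set" where
    C: "\<And>P. {n. P n} \<in> I \<longleftrightarrow> (\<exists>k. P \<in> C k)" "\<And>k. closed (C k)"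
    using fsigma_idealE by metis
  from P_ideal_pseudo_union[OF assms(2), of g] obtain B where B: "B \<in> I"
    "\<And>t u. differ (g t) (g u) \<in> I \<Longrightarrow> finite (differ (g t) (g u) - B)" by blast
  define bounds where "bounds t u k m \<longleftrightarrow>
    (differ (g t) (g u) \<in> I \<longrightarrow> (\<forall>n\<ge>m. n \<notin> B \<longrightarrow> g t n = g u n)) \<and>
    (differ (g t) (g u) \<notin> I \<longrightarrow> (\<forall>A. (\<forall>n<m. n \<in> A \<longleftrightarrow> g t n \<noteq> g u n) \<longrightarrow> (\<lambda>n. n \<in> A) \<notin> C k))"
    for t u k m
  have "\<exists>m. bounds t u k m" for t u k
  proof (cases "differ (g t) (g u) \<in> I")
    case True
    from B(2)[OF True] obtain m where "\<And>n. n \<in> differ (g t) (g u) - B \<Longrightarrow> n < m"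
      unfolding finite_nat_set_iff_bounded by blast
    then have "g t n = g u n" if "n \<ge> m" "n \<notin> B" for n using that not_le by blast
    with True show ?thesis unfolding bounds_def by (intro exI[of _ m]) simp
  next
    case False
    then have "(\<lambda>n. g t n \<noteq> g u n) \<notin> C k" using C(1)[of "\<lambda>n. g t n \<noteq> g u n"] by blast
    from closed_agreement[OF C(2) this] obtain m where
      m: "\<And>v. (\<And>n. n < m \<Longrightarrow> v n = (g t n \<noteq> g u n)) \<Longrightarrow> v \<notin> C k" by blast
    show ?thesis using False m unfolding bounds_def by (intro exI[of _ m]) simp
  qed
  then obtain b where b: "\<And>t u k. bounds t u k (b t u k)"
    by metis
  show thesis
  proof (rule that[OF B(1), of C b])
    show "\<exists>k. (\<lambda>n. n \<in> A) \<in> C k" if "A \<in> I" for A using C(1)[of "\<lambda>n. n \<in> A"] that by simp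
    show "g t n = g u n" if "differ (g t) (g u) \<in> I" "b t u k \<le> n" "n \<notin> B" for t u k n
      using b[of t u k] that unfolding bounds_def by blast
    show "(\<lambda>n. n \<in> A) \<notin> C k" if "differ (g t) (g u) \<notin> I"
      "\<And>n. n < b t u k \<Longrightarrow> n \<in> A \<longleftrightarrow> g t n \<noteq> g u n" for t u k A
      using b[of t u k] that unfolding bounds_def by blast
  qed
qed

text \<open>The split asks whether some subtree, with whatever stem, has all its values in one class
  modulo \<open>I\<close> and initial segments. If none has, the limits are fixed on a whole tree
  first, since the bounds \<open>b\<close> computed from them must be available while the subtree is
  enumerated.\<close>

lemma (in laver_reduction) canonical_subtree:
  assumes P: "P_ideal I" and T: "laver_at s T"
  shows "\<exists>S t. laver_at t S \<and> S \<subseteq> T \<and>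
    ((\<forall>x\<in>branches S. \<forall>y\<in>branches S. differ (f x) (f y) \<in> I) \<or>
     (\<forall>x\<in>branches S. \<forall>y\<in>branches S. x \<noteq> y \<longrightarrow> differ (f x) (f y) \<notin> I))"
proof (cases "\<exists>t U z N. laver_at t U \<and> U \<subseteq> T \<and> (\<forall>x\<in>branches U. differ (f x) z - {..<N} \<in> I)")
  case True
  then obtain t U z N where U: "laver_at t U" "U \<subseteq> T" "\<And>x. x \<in> branches U \<Longrightarrow> differ (f x) z - {..<N} \<in> I"
    by blast
  from equivalent_subtree[OF U] obtain S where "S \<subseteq> U" "laver_at t S"
    "\<forall>x\<in>branches S. \<forall>y\<in>branches S. differ (f x) (f y) \<in> I" by blast
  with U(2) show ?thesis by (intro exI[of _ S] exI[of _ t]) simp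
next
  case False
  then have no_class: "\<exists>x\<in>branches U. differ (f x) z - {..<N} \<notin> I"
    if "laver_at t U" "U \<subseteq> T" for t U z N
    using that by blast
  show ?thesis
  proof (rule limit_tree[OF no_class T])
    fix S g
    assume S: "S \<subseteq> T" "laver_at s S"
      and limit: "\<And>t x N. t \<in> S \<Longrightarrow> prefix s t \<Longrightarrow> x \<in> branches S \<Longrightarrow> seg x (length t) = t \<Longrightarrow>
        differ (f x) (g t) - {..<N} \<notin> I"
      and follow: "\<And>t k. t \<in> S \<Longrightarrow> prefix s t \<Longrightarrow>
        \<exists>m. \<forall>n\<ge>m. \<forall>x\<in>branches S. seg x (Suc (length t)) = t @ [n] \<longrightarrow> (\<forall>i<k. f x i = g t i)"
    show ?thesis
    proof (rule agreement_bounds[OF fsigma P, of g])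
      fix B b and C :: "nat \<Rightarrow> (nat \<Rightarrow> bool) set"
      assume B: "B \<in> I" "\<And>A. A \<in> I \<Longrightarrow> \<exists>k. (\<lambda>n. n \<in> A) \<in> C k"
        "\<And>t u k n. differ (g t) (g u) \<in> I \<Longrightarrow> b t u k \<le> n \<Longrightarrow> n \<notin> B \<Longrightarrow> g t n = g u n"
        "\<And>t u k A. differ (g t) (g u) \<notin> I \<Longrightarrow>
          (\<And>n. n < b t u k \<Longrightarrow> n \<in> A \<longleftrightarrow> g t n \<noteq> g u n) \<Longrightarrow> (\<lambda>n. n \<in> A) \<notin> C k"
      from enumerated_tree_exists[where f = f and g = g and b = b, OF S(2) follow]
      obtain \<sigma> where "enumerated_tree s S \<sigma> (\<lambda>j. fst (prod_decode j)) f g b" by blast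
      then interpret enumerated_tree s S \<sigma> "\<lambda>j. fst (prod_decode j)" f g b .
      have "differ (f x) (f y) \<notin> I" if "x \<in> branches tree" "y \<in> branches tree" "x \<noteq> y" for x y
        by (rule branches_inequivalent[OF ideal B limit that])
      moreover have "tree \<subseteq> T" using tree_subset \<open>S \<subseteq> T\<close> by (rule subset_trans)
      ultimately show ?thesis
        using laver_at_tree by (intro exI[of _ tree] exI[of _ s]) simp
    qed
  qed
qed

theorem theorem0p1:
  fixes T :: "nat list set"
    and I :: "nat set set"
    and E :: "((nat \<Rightarrow> nat) \<times> (nat \<Rightarrow> nat)) set"
  assumes "laver_tree T"
    and "fsigma_ideal I"
    and "P_ideal I"
    and "borel_equivalence (branch_space T) E"
    and "borel_reducible (branch_space T) E (borel :: (nat \<Rightarrow> bool) measure) (E_ideal I)"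
  shows "\<exists>S. laver_tree S \<and> S \<subseteq> T \<and>
           (E \<inter> (branches S \<times> branches S) = Id_on (branches S) \<or>
            E \<inter> (branches S \<times> branches S) = branches S \<times> branches S)"
proof -
  from assms(5) obtain f where f: "f \<in> measurable (branch_space T) (borel :: (nat \<Rightarrow> bool) measure)"
    and red: "\<And>x y. x \<in> branches T \<Longrightarrow> y \<in> branches T \<Longrightarrow> (x, y) \<in> E \<longleftrightarrow> differ (f x) (f y) \<in> I"
    unfolding borel_reducible_def E_ideal_def branch_space_def space_restrict_space by auto
  interpret laver_reduction T I f
    using assms(2) f by unfold_locales
  obtain s where "laver_at s T" using assms(1) laver_tree_iff by blast
  from canonical_subtree[OF assms(3) this] obtain S t where S: "laver_at t S" "S \<subseteq> T"
    "(\<forall>x\<in>branches S. \<forall>y\<in>branches S. differ (f x) (f y) \<in> I) \<or>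
     (\<forall>x\<in>branches S. \<forall>y\<in>branches S. x \<noteq> y \<longrightarrow> differ (f x) (f y) \<notin> I)" by blast
  have E: "(x, y) \<in> E \<longleftrightarrow> differ (f x) (f y) \<in> I" if "x \<in> branches S" "y \<in> branches S" for x y
    using that branches_mono[OF S(2)] by (intro red) auto
  have S_laver: "laver_tree S" using S(1) laver_tree_iff by blast
  from S(3) show ?thesis
  proof
    assume "\<forall>x\<in>branches S. \<forall>y\<in>branches S. differ (f x) (f y) \<in> I"
    then have "E \<inter> (branches S \<times> branches S) = branches S \<times> branches S" using E by auto
    with S(2) S_laver show ?thesis by (intro exI[of _ S] conjI disjI2)
  next
    assume ne: "\<forall>x\<in>branches S. \<forall>y\<in>branches S. x \<noteq> y \<longrightarrow> differ (f x) (f y) \<notin> I"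
    \<comment> \<open>The empty set in \<open>I\<close> makes the diagonal part of \<open>E\<close>,
      which upgrades pairwise inequivalence to the identity relation.\<close>
    have "{} \<in> I" using ideal by (simp add: is_ideal_def)
    then have "(x, x) \<in> E" if "x \<in> branches S" for x using E that by simp
    with E ne have "(x, y) \<in> E \<longleftrightarrow> x = y" if "x \<in> branches S" "y \<in> branches S" for x y
      using that by blast
    then have "E \<inter> (branches S \<times> branches S) = Id_on (branches S)" by (auto simp: Id_on_iff)
    with S(2) S_laver show ?thesis by (intro exI[of _ S] conjI disjI1)
  qed
qed

end
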